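(* For every $\alpha\in\mathbb{P}^1(\overline{\mathbb{Q}})\setminus\{0,\infty\}$ one has $h_{\mathrm{Ar}}(\alpha)\geq\frac{1}{2}\log 2$. Moreover, $h_{\mathrm{Ar}}(\alpha)=\frac{1}{2}\log 2$ if and only if $\alpha$ is a root of unity.
   Context: Identify $\mathbb{P}^1(\overline{\mathbb{Q}})=\overline{\mathbb{Q}}\cup\{\infty\}$ via $\alpha=(\alpha:1)$, $\infty=(1:0)$. Let $M_{\mathbb{Q}}=\{\infty,2,3,5,\dots\}$ be the places of $\mathbb{Q}$, with $|\cdot|_v$ the absolute value on $\mathbb{C}_v$ extending the usual real or $p$-adic absolute value. For $v=\infty$ set $\|(x_0,x_1)\|_v=(|x_0|^2+|x_1|^2)^{1/2}$, and for $v=p$ prime set $\|(x_0,x_1)\|_v=\max(|x_0|_v,|x_1|_v)$. The Arakelov height of $\alpha=(\alpha_0:\alpha_1)\in\mathbb{P}^1(\overline{\mathbb{Q}})$ is $h_{\mathrm{Ar}}(\alpha)=\frac{1}{[K:\mathbb{Q}]}\sum_{v\in M_{\mathbb{Q}}}\sum_{\sigma:K\hookrightarrow\mathbb{C}_v}\log\|(\sigma(\alpha_0),\sigma(\alpha_1))\|_v$, where $K$ is any number field containing $\alpha_0,\alpha_1$ and the inner sum is over all $[K:\mathbb{Q}]$ embeddings of $K$ into $\mathbb{C}_v$ (this is independent of choices). *)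

theory Defs
  imports
    "HOL-Analysis.Analysis"
    "HOL-Algebra.Algebra"
    "HOL-Algebra.Algebraic_Closure_Type"
begin

section \<open>The projective line over the algebraic numbers\<close>

definition Qbar :: "complex set" where
  "Qbar = {z. Polynomial.algebraic z}"

definition homog_coords :: "(complex \<times> complex) set" where
  "homog_coords = Qbar \<times> Qbar - {(0, 0)}"

definition proj_rel :: "((complex \<times> complex) \<times> (complex \<times> complex)) set" where
  "proj_rel = {((x0, x1), (y0, y1)). (x0, x1) \<in> homog_coords \<and> (y0, y1) \<in> homog_coords \<and>
      (\<exists>c\<in>Qbar - {0}. y0 = c * x0 \<and> y1 = c * x1)}"

definition P1_Qbar :: "(complex \<times> complex) set set" where
  "P1_Qbar = homog_coords // proj_rel"

definition proj_point :: "complex \<Rightarrow> complex \<Rightarrow> (complex \<times> complex) set" where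
  "proj_point x0 x1 = proj_rel `` {(x0, x1)}"

abbreviation affine_point :: "complex \<Rightarrow> (complex \<times> complex) set" where
  "affine_point z \<equiv> proj_point z 1"

abbreviation infinity_point :: "(complex \<times> complex) set" where
  "infinity_point \<equiv> proj_point 1 0"


section \<open>The fields of p-adic complex numbers\<close>

definition padic_abs :: "nat \<Rightarrow> rat \<Rightarrow> real" where
  "padic_abs p q = (if q = 0 then 0 else
     (case quotient_of q of (a, b) \<Rightarrow>
        real p powi (int (multiplicity (int p) b) - int (multiplicity (int p) a))))"

locale nonarch_valued_field = field C for C (structure) +
  fixes av :: "'a \<Rightarrow> real"
  assumes av_nonneg: "x \<in> carrier C \<Longrightarrow> 0 \<le> av x"
    and av_eq_0_iff: "x \<in> carrier C \<Longrightarrow> av x = 0 \<longleftrightarrow> x = \<zero>"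
    and av_mult: "\<lbrakk>x \<in> carrier C; y \<in> carrier C\<rbrakk> \<Longrightarrow> av (x \<otimes> y) = av x * av y"
    and av_add: "\<lbrakk>x \<in> carrier C; y \<in> carrier C\<rbrakk> \<Longrightarrow> av (x \<oplus> y) \<le> max (av x) (av y)"
begin

text \<open>The guard is needed because the locale \<open>Metric_space\<close> requires symmetry and
  nonnegativity of the distance also outside of the carrier.\<close>

definition vdist :: "'a \<Rightarrow> 'a \<Rightarrow> real" where
  "vdist x y = (if x \<in> carrier C \<and> y \<in> carrier C then av (x \<ominus> y) else 0)"

definition rat_embed :: "rat \<Rightarrow> 'a" where
  "rat_embed q = (case quotient_of q of (a, b) \<Rightarrow> ([a] \<cdot> \<one>) \<otimes> inv ([b] \<cdot> \<one>))"

text \<open>Inside a complete field, the completion of the rationals is their topological closure.\<close>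

definition Qp :: "'a set" where
  "Qp = Metric_space.mtopology (carrier C) vdist closure_of range rat_embed"

definition Qp_bar :: "'a set" where
  "Qp_bar = {x \<in> carrier C. (algebraic over Qp) x}"

lemma av_one: "av \<one> = 1"
proof -
  have "av \<one> = av \<one> * av \<one>"
    using av_mult[of \<one> \<one>] by simp
  moreover have "av \<one> \<noteq> 0"
    using av_eq_0_iff[of \<one>] by simp
  ultimately show ?thesis by simp
qed

lemma av_minus: assumes "x \<in> carrier C" shows "av (\<ominus> x) = av x"
proof -
  have "av (\<ominus> \<one>) * av (\<ominus> \<one>) = 1"
    using av_mult[of "\<ominus> \<one>" "\<ominus> \<one>"] av_one by (simp add: l_minus r_minus)
  hence "av (\<ominus> \<one>) = 1"
    using av_nonneg[of "\<ominus> \<one>"] by (simp add: square_eq_1_iff)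
  thus ?thesis
    using av_mult[of "\<ominus> \<one>" x] assms by (simp add: l_minus)
qed

lemma Metric_space_vdist: "Metric_space (carrier C) vdist"
proof
  fix x y
  show "0 \<le> vdist x y" by (simp add: vdist_def av_nonneg)
  have "\<ominus> (x \<ominus> y) = y \<ominus> x" if "x \<in> carrier C" "y \<in> carrier C"
    using that by (simp add: a_minus_def minus_add a_comm)
  thus "vdist x y = vdist y x"
    using av_minus[of "x \<ominus> y"] by (auto simp: vdist_def)
next
  fix x y assume "x \<in> carrier C" "y \<in> carrier C"
  thus "vdist x y = 0 \<longleftrightarrow> x = y"
    by (simp add: vdist_def av_eq_0_iff)
next
  fix x y z assume xyz: "x \<in> carrier C" "y \<in> carrier C" "z \<in> carrier C"
  have "(x \<ominus> y) \<oplus> (y \<ominus> z) = x \<ominus> z"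
    using xyz by (simp add: a_minus_def a_assoc r_neg1)
  hence "av (x \<ominus> z) \<le> max (av (x \<ominus> y)) (av (y \<ominus> z))"
    using av_add[of "x \<ominus> y" "y \<ominus> z"] xyz by simp
  thus "vdist x z \<le> vdist x y + vdist y z"
    using xyz av_nonneg[of "x \<ominus> y"] av_nonneg[of "y \<ominus> z"] by (simp add: vdist_def)
qed

end

text \<open>
  \<open>padic_complex C av p\<close> says that the field \<open>C\<close> with the absolute value \<open>av\<close> is a completion
  of an algebraic closure of the field of p-adic numbers, with the absolute value extending the
  p-adic one. These conditions determine \<open>(C, av)\<close> up to isometric isomorphism.
\<close>

locale padic_complex = nonarch_valued_field C av
  for C :: "'a ring" (structure) and av :: "'a \<Rightarrow> real" and p :: nat +
  assumes av_rat: "av (rat_embed q) = padic_abs p q"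
    and complete: "Metric_space.mcomplete (carrier C) vdist"
    and algebraic_closure_Qp: "algebraic_closure (C\<lparr>carrier := Qp_bar\<rparr>) Qp"
    and dense: "Metric_space.mtopology (carrier C) vdist closure_of Qp_bar = carrier C"


section \<open>The Arakelov height\<close>

abbreviation CC :: "complex ring" where
  "CC \<equiv> ring_of_type_algebra"

definition number_field :: "complex set \<Rightarrow> bool" where
  "number_field K \<longleftrightarrow> subfield K CC \<and> ring.finite_dimension CC \<rat> K"

definition embeddings :: "complex set \<Rightarrow> 'b ring \<Rightarrow> (complex \<Rightarrow> 'b) set" where
  "embeddings K L = ring_hom (CC\<lparr>carrier := K\<rparr>) L \<inter> extensional K"

text \<open>
  The height computed with the number field \<open>K\<close> and the homogeneous coordinates \<open>(a0 : a1)\<close>,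
  where \<open>C p\<close> with \<open>av p\<close> is the field of p-adic complex numbers. The first sum is the
  contribution of the archimedean place; all but finitely many terms of the sum over the
  primes vanish.
\<close>

definition arakelov_height ::
  "(nat \<Rightarrow> 'c ring) \<Rightarrow> (nat \<Rightarrow> 'c \<Rightarrow> real) \<Rightarrow> complex set \<Rightarrow> complex \<Rightarrow> complex \<Rightarrow> real" where
  "arakelov_height C av K a0 a1 = 1 / real (ring.dim CC \<rat> K) *
     ((\<Sum>\<sigma>\<in>embeddings K CC. ln (sqrt ((cmod (\<sigma> a0))\<^sup>2 + (cmod (\<sigma> a1))\<^sup>2)))
      + (\<Sum>\<^sub>\<infinity>p\<in>{p. Factorial_Ring.prime p}.
           \<Sum>\<sigma>\<in>embeddings K (C p). ln (max (av p (\<sigma> a0)) (av p (\<sigma> a1)))))"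

end

(* The embeddings of K = Q(z) into C_p are the compositions of the complex embeddings with one fixed
   embedding of a normal closure of K, because C_p contains a root of the minimal polynomial of a
   primitive element of that closure. So the height is a sum over pairs of a complex embedding and an
   absolute value of the normal closure. Termwise, x^2 + y^2 >= 2xy at infinity and max(x, y)^2 >= xy
   at the primes; the right-hand sides add up to (log 2)/2 by the product formula for the norms of a0
   and a1. Equality forces |tau(a0/a1)| = 1 at all places, hence a0/a1 is a root of unity by Kronecker:
   the characteristic polynomials of its powers have bounded integer coefficients. *)

theory Submission
  imports Defs
begin

section \<open>Minimal polynomials over the rationals\<close>

text \<open>Composing with one fixed embedding per prime gives the p-adic sums the same index set as
  the archimedean sum. The product formula for K thereby becomes that of a single rational number,
  the product of all -tau(u), read at every place. Its rationality comes from counting roots: an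
  element of \<open>adj t\<close> fixed by all complex embeddings of \<open>adj t\<close> is
  rational, and composing with such an embedding merely permutes the embeddings of K. The same
  argument makes all coefficients of the characteristic polynomial rational. Only the finitely many
  primes in the denominators of these coefficients (for u and for 1/u) can see a conjugate of u with
  value different from 1, which turns the infinite sum of the height into a finite one. A practical
  obstacle is that C_p is a structure with a carrier, while polynomials have coefficients in type
  classes. Evaluation along a homomorphism from one world to the other (\<open>hom_on.ev\<close>)
  bridges the two.\<close>

definition rpoly :: "rat poly \<Rightarrow> complex \<Rightarrow> complex" where
  "rpoly g z = poly (map_poly of_rat g) z"

lemma rpoly_0 [simp]: "rpoly 0 z = 0"
  by (simp add: rpoly_def)

lemma rpoly_pCons [simp]: "rpoly (pCons a g) z = of_rat a + z * rpoly g z"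
  by (cases "a = 0 \<and> g = 0") (auto simp: rpoly_def map_poly_pCons)

lemma rpoly_1 [simp]: "rpoly 1 z = 1"
  by (simp add: one_pCons)

lemma rpoly_add [simp]: "rpoly (g + h) z = rpoly g z + rpoly h z"
  by (induction g h rule: poly_induct2) (auto simp: of_rat_add algebra_simps)

lemma rpoly_uminus [simp]: "rpoly (- g) z = - rpoly g z"
  by (induction g) (auto simp: of_rat_minus)

lemma rpoly_diff [simp]: "rpoly (g - h) z = rpoly g z - rpoly h z"
  using rpoly_add[of g "-h" z] by simp

lemma rpoly_smult [simp]: "rpoly (Polynomial.smult c g) z = of_rat c * rpoly g z"
  by (induction g) (auto simp: of_rat_mult algebra_simps)

lemma rpoly_mult [simp]: "rpoly (g * h) z = rpoly g z * rpoly h z"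
  by (induction g) (auto simp: algebra_simps)

lemma rpoly_pcompose [simp]: "rpoly (pcompose g h) z = rpoly g (rpoly h z)"
  by (induction g) (auto simp: pcompose_pCons)

lemma map_poly_of_rat_eq_0_iff [simp]: "map_poly (of_rat :: rat \<Rightarrow> complex) g = 0 \<longleftrightarrow> g = 0"
  by (simp add: map_poly_eq_0_iff)

lemma degree_map_poly_of_rat [simp]:
  "Polynomial.degree (map_poly (of_rat :: rat \<Rightarrow> complex) g) = Polynomial.degree g"
  by (rule degree_map_poly) auto

lemma pderiv_map_poly_of_rat:
  "pderiv (map_poly (of_rat :: rat \<Rightarrow> complex) g) = map_poly of_rat (pderiv g)"
  by (rule poly_eqI) (simp add: coeff_pderiv coeff_map_poly of_rat_mult of_rat_add)

lemma algebraic_iff_rpoly: "Polynomial.algebraic z \<longleftrightarrow> (\<exists>g. g \<noteq> 0 \<and> rpoly g z = 0)"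
proof
  assume "Polynomial.algebraic z"
  then obtain p where p: "p \<noteq> 0" "poly (map_poly of_int p) z = 0"
    by (rule algebraicE')
  have "map_poly (of_rat :: rat \<Rightarrow> complex) (map_poly of_int p) = map_poly of_int p"
    by (subst map_poly_map_poly) (auto simp: o_def)
  moreover have "map_poly (of_int :: int \<Rightarrow> rat) p \<noteq> 0"
    using p(1) by (simp add: map_poly_eq_0_iff)
  ultimately show "\<exists>g. g \<noteq> 0 \<and> rpoly g z = 0"
    using p(2) by (intro exI[of _ "map_poly of_int p"]) (simp add: rpoly_def)
next
  assume "\<exists>g. g \<noteq> 0 \<and> rpoly g z = 0"
  then obtain g where g: "g \<noteq> 0" "rpoly g z = 0"
    by blast
  thus "Polynomial.algebraic z"
    by (intro algebraicI'[of "map_poly of_rat g"]) (auto simp: rpoly_def coeff_map_poly)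
qed

text \<open>Phrased through the annihilator ideal instead of irreducibility or least degree, because
  divisibility is what the later arguments consume.\<close>

definition minpoly_of :: "rat poly \<Rightarrow> complex \<Rightarrow> bool" where
  "minpoly_of f z \<longleftrightarrow> Polynomial.lead_coeff f = 1 \<and> (\<forall>g. rpoly g z = 0 \<longleftrightarrow> f dvd g)"

lemma minpoly_ofD:
  assumes "minpoly_of f z"
  shows "Polynomial.lead_coeff f = 1" "f \<noteq> 0" "rpoly f z = 0" "rpoly g z = 0 \<longleftrightarrow> f dvd g"
  using assms by (auto simp: minpoly_of_def)

lemma minpoly_of_degree_pos:
  assumes "minpoly_of f z"
  shows "Polynomial.degree f > 0"
proof (rule ccontr)
  assume "\<not> Polynomial.degree f > 0"
  then obtain c where "f = [:c:]"
    by (auto elim: degree_eq_zeroE)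
  thus False
    using minpoly_ofD(2,3)[OF assms] by simp
qed

lemma minpoly_of_exists:
  assumes "Polynomial.algebraic z"
  shows "\<exists>f. minpoly_of f z"
proof -
  define P where "P g \<longleftrightarrow> g \<noteq> 0 \<and> rpoly g z = 0" for g
  have ex: "\<exists>g. P g"
    using assms algebraic_iff_rpoly P_def by blast
  define g where "g = (ARG_MIN Polynomial.degree g. P g)"
  have g: "g \<noteq> 0" "rpoly g z = 0"
    using arg_min_natI[of P] ex unfolding g_def P_def by blast+
  have g_min: "Polynomial.degree g \<le> Polynomial.degree h" if "h \<noteq> 0" "rpoly h z = 0" for h
    using arg_min_nat_le[of P h Polynomial.degree] that unfolding g_def P_def by blast
  define f where "f = Polynomial.smult (inverse (Polynomial.lead_coeff g)) g"
  have monic: "Polynomial.lead_coeff f = 1" and f0: "f \<noteq> 0" and fz: "rpoly f z = 0"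
    using g by (auto simp: f_def)
  have deg: "Polynomial.degree f = Polynomial.degree g"
    using g by (simp add: f_def)
  have "f dvd h" if h: "rpoly h z = 0" for h
  proof -
    have "rpoly (h mod f) z = 0"
      using h fz by (simp add: minus_div_mult_eq_mod [symmetric])
    hence "h mod f = 0"
      using g_min[of "h mod f"] degree_mod_less[OF f0, of h] deg by force
    thus ?thesis
      by (simp add: mod_eq_0_iff_dvd)
  qed
  moreover have "rpoly h z = 0" if "f dvd h" for h
    using that fz by (auto elim!: dvdE)
  ultimately have "minpoly_of f z"
    using monic unfolding minpoly_of_def by auto
  thus ?thesis ..
qed

text \<open>The annihilator of z is the kernel of evaluation into a domain, hence a prime
  ideal.\<close>

lemma minpoly_of_prime_elem:
  assumes "minpoly_of f z"
  shows "prime_elem f"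
proof (rule prime_elemI)
  show "f \<noteq> 0" using minpoly_ofD[OF assms] by blast
  show "\<not> f dvd 1"
    using minpoly_ofD(4)[OF assms, of 1] by simp
  fix a b assume "f dvd a * b"
  thus "f dvd a \<or> f dvd b"
    by (metis minpoly_ofD(4)[OF assms] mult_eq_0_iff rpoly_mult)
qed

lemma minpoly_of_bezout:
  assumes "minpoly_of f z" "\<not> f dvd g"
  obtains u v where "u * f + v * g = 1"
proof -
  have "coprime f g"
    using prime_elem_imp_coprime[OF minpoly_of_prime_elem[OF assms(1)] assms(2)] .
  hence "fst (bezout_coefficients f g) * f + snd (bezout_coefficients f g) * g = 1"
    by (metis bezout_coefficients_fst_snd coprime_imp_gcd_eq_1)
  thus ?thesis
    by (rule that)
qed

text \<open>Conjugates share their minimal polynomial: if g kills w but is not a multiple of f, a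
  Bezout relation for f and g evaluates at w to 0 = 1.\<close>

lemma minpoly_of_root:
  assumes "minpoly_of f z" "rpoly f w = 0"
  shows "minpoly_of f w"
proof -
  have "f dvd g" if "rpoly g w = 0" for g
  proof (rule ccontr)
    assume "\<not> f dvd g"
    then obtain u v where "u * f + v * g = 1"
      using minpoly_of_bezout[OF assms(1)] by blast
    hence "rpoly (u * f + v * g) w = 1" by simp
    thus False using that assms(2) by simp
  qed
  moreover have "rpoly g w = 0" if "f dvd g" for g
    using that assms(2) by (auto elim!: dvdE)
  ultimately show ?thesis
    using assms(1) unfolding minpoly_of_def by blast
qed

text \<open>A double root a also has minimal polynomial f, so f would divide its own derivative,
  which is nonzero and of smaller degree. Consequently f has exactly as many complex roots as its
  degree.\<close>

lemma minpoly_of_rsquarefree: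
  assumes "minpoly_of f z"
  shows "rsquarefree (map_poly (of_rat :: rat \<Rightarrow> complex) f)"
  unfolding rsquarefree_roots
proof safe
  fix a :: complex
  assume a: "poly (map_poly of_rat f) a = 0" "poly (pderiv (map_poly of_rat f)) a = 0"
  have "minpoly_of f a"
    using minpoly_of_root[OF assms] a(1) by (simp add: rpoly_def)
  moreover have "rpoly (pderiv f) a = 0"
    using a(2) by (simp add: pderiv_map_poly_of_rat rpoly_def)
  ultimately have "f dvd pderiv f"
    using minpoly_ofD(4) by blast
  moreover have "pderiv f \<noteq> 0"
    using minpoly_of_degree_pos[OF assms] by (simp add: pderiv_eq_0_iff)
  ultimately have "Polynomial.degree f \<le> Polynomial.degree (pderiv f)"
    by (rule dvd_imp_degree_le)
  thus False
    using minpoly_of_degree_pos[OF assms] by (simp add: degree_pderiv)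
qed

lemma minpoly_of_decompose:
  assumes "minpoly_of f z"
  shows "map_poly (of_rat :: rat \<Rightarrow> complex) f = (\<Prod>w | rpoly f w = 0. [:- w, 1:])"
  using complex_poly_decompose_rsquarefree[OF minpoly_of_rsquarefree[OF assms]] minpoly_ofD(1)[OF assms]
  by (simp add: rpoly_def coeff_map_poly)

lemma finite_rpoly_roots: "f \<noteq> 0 \<Longrightarrow> finite {w. rpoly f w = 0}"
  by (simp add: rpoly_def poly_roots_finite)

lemma card_rpoly_roots:
  assumes "minpoly_of f z"
  shows "card {w. rpoly f w = 0} = Polynomial.degree f"
proof -
  have "Polynomial.degree (map_poly (of_rat :: rat \<Rightarrow> complex) f) = (\<Sum>w | rpoly f w = 0. 1)"
    unfolding minpoly_of_decompose[OF assms]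
    by (subst degree_prod_eq_sum_degree) auto
  thus ?thesis by simp
qed

text \<open>For algebraic z this is the field Q(z): polynomial values suffice, since a Bezout
  relation with the minimal polynomial supplies inverses (\<open>adj_inverse\<close>).\<close>

definition adj :: "complex \<Rightarrow> complex set" where
  "adj z = range (\<lambda>g. rpoly g z)"

lemma adjI [intro]: "rpoly g z \<in> adj z"
  by (auto simp: adj_def)

lemma adjE: assumes "x \<in> adj z" obtains g where "x = rpoly g z"
  using assms by (auto simp: adj_def)

lemma adj_self: "z \<in> adj z"
  using adjI[of "[:0, 1:]" z] by simp

lemma adj_of_rat: "of_rat q \<in> adj z"
  using adjI[of "[:q:]" z] by simp

lemma adj_add: "x \<in> adj z \<Longrightarrow> y \<in> adj z \<Longrightarrow> x + y \<in> adj z"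
  by (metis adjE adjI rpoly_add)

lemma adj_mult: "x \<in> adj z \<Longrightarrow> y \<in> adj z \<Longrightarrow> x * y \<in> adj z"
  by (metis adjE adjI rpoly_mult)

lemma adj_uminus: "x \<in> adj z \<Longrightarrow> - x \<in> adj z"
  by (metis adjE adjI rpoly_uminus)

lemma adj_rpoly: "x \<in> adj z \<Longrightarrow> rpoly g x \<in> adj z"
  by (metis adjE adjI rpoly_pcompose)

lemma adj_inverse:
  assumes "Polynomial.algebraic z" "x \<in> adj z"
  shows "inverse x \<in> adj z"
proof (cases "x = 0")
  case True
  thus ?thesis using assms(2) by simp
next
  case False
  obtain f where f: "minpoly_of f z"
    using minpoly_of_exists[OF assms(1)] by blast
  obtain g where g: "x = rpoly g z"
    using assms(2) by (rule adjE)
  have "\<not> f dvd g"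
    using False minpoly_ofD(4)[OF f] g by simp
  then obtain u v where "u * f + v * g = 1"
    using minpoly_of_bezout[OF f] by blast
  hence "rpoly (u * f + v * g) z = 1" by simp
  hence "rpoly v z * x = 1"
    using minpoly_ofD(3)[OF f] g by simp
  hence "inverse x = rpoly v z"
    by (metis inverse_unique mult.commute)
  thus ?thesis by (simp add: adjI)
qed

section \<open>Primitive elements of number fields\<close>

lemma CC_simps [simp]:
  "carrier CC = UNIV" "x \<otimes>\<^bsub>CC\<^esub> y = x * y" "x \<oplus>\<^bsub>CC\<^esub> y = x + y" "\<one>\<^bsub>CC\<^esub> = 1" "\<zero>\<^bsub>CC\<^esub> = 0"
  by (simp_all add: ring_of_type_algebra_def)

interpretation CC: domain CC
  by (rule field.axioms(1)[OF field_from_type_algebra])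

lemma CC_pow [simp]: "x [^]\<^bsub>CC\<^esub> (n::nat) = x ^ n"
  by (induction n) (auto simp: mult.commute)

lemma CC_uminus [simp]: "\<ominus>\<^bsub>CC\<^esub> x = - x"
  using CC.minus_equality[of "-x" x] by simp

lemma CC_inv [simp]: "x \<noteq> 0 \<Longrightarrow> inv\<^bsub>CC\<^esub> x = inverse x"
  using CC.inv_char[of x "inverse x"] by simp

lemma subfield_Rats: "subfield \<rat> CC"
  by (rule field.subfieldI'[OF field_from_type_algebra CC.subringI]) auto

lemma CC_eval: "CC.eval xs z = poly (Poly (rev xs)) z"
  by (induction xs) (auto simp: Poly_append poly_monom)

text \<open>HOL-Algebra represents a polynomial by its coefficient list with a nonzero leading
  coefficient in front, and zero by the empty list; \<open>coeffs\<close> lists them in the opposite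
  order.\<close>

definition rat_list :: "rat poly \<Rightarrow> complex list" where
  "rat_list g = map of_rat (rev (coeffs g))"

lemma eval_rat_list: "CC.eval (rat_list g) z = rpoly g z"
proof -
  have "Poly (map of_rat (coeffs g)) = map_poly (of_rat :: rat \<Rightarrow> complex) g"
    by (simp add: map_poly_def)
  thus ?thesis
    by (simp add: CC_eval rat_list_def rpoly_def flip: rev_map)
qed

lemma length_rat_list: "length (rat_list g) - 1 = Polynomial.degree g"
  by (auto simp: rat_list_def degree_eq_length_coeffs)

lemma rat_list_carrier: "rat_list g \<in> carrier (\<rat>[X]\<^bsub>CC\<^esub>)"
  by (cases "g = 0")
     (auto simp: univ_poly_def polynomial_def rat_list_def hd_map hd_rev last_coeffs_eq_coeff_degree)

lemma rat_list_eq_Nil_iff: "rat_list g = [] \<longleftrightarrow> g = 0"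
  by (simp add: rat_list_def)

lemma rat_list_surj:
  assumes "p \<in> carrier (\<rat>[X]\<^bsub>CC\<^esub>)"
  obtains g where "p = rat_list g"
proof -
  have p: "set p \<subseteq> \<rat>" "p \<noteq> [] \<Longrightarrow> hd p \<noteq> 0"
    using assms by (auto simp: univ_poly_def polynomial_def)
  obtain q :: "rat list" where q: "p = map of_rat q"
    using p(1) by (metis Rats_def ex_map_conv subset_code(1) image_iff)
  have "coeffs (Poly (rev q)) = rev q"
  proof (rule coeffs_Poly[THEN trans])
    show "strip_while (HOL.eq 0) (rev q) = rev q"
      using p(2) q by (cases q) auto
  qed
  hence "p = rat_list (Poly (rev q))"
    by (simp add: rat_list_def q)
  thus ?thesis by (rule that)
qed

lemma CC_algebraic_iff: "(CC.algebraic over \<rat>) z \<longleftrightarrow> Polynomial.algebraic z"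
proof
  assume "(CC.algebraic over \<rat>) z"
  then obtain p where "p \<in> carrier (\<rat>[X]\<^bsub>CC\<^esub>)" "p \<noteq> []" "CC.eval p z = 0"
    using CC.algebraicE[OF subfieldE(1)[OF subfield_Rats], of z] by auto
  thus "Polynomial.algebraic z"
    by (metis algebraic_iff_rpoly eval_rat_list rat_list_eq_Nil_iff rat_list_surj)
next
  assume "Polynomial.algebraic z"
  then obtain g where "g \<noteq> 0" "rpoly g z = 0"
    using algebraic_iff_rpoly by blast
  thus "(CC.algebraic over \<rat>) z"
    using CC.algebraicI[OF rat_list_carrier, of g z]
    by (simp add: rat_list_eq_Nil_iff eval_rat_list)
qed

text \<open>Closure of the algebraic numbers under sums and products is taken from the HOL-Algebra
  theorem on elements algebraic over a subfield.\<close>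

lemma subfield_algebraic: "subfield {z. Polynomial.algebraic z} CC"
  using field.subfield_of_algebraics[OF field_from_type_algebra subfield_Rats] by (simp add: CC_algebraic_iff)

lemma algebraic_add: "Polynomial.algebraic x \<Longrightarrow> Polynomial.algebraic y \<Longrightarrow> Polynomial.algebraic (x + y :: complex)"
  using subringE(7)[OF subfieldE(1)[OF subfield_algebraic], of x y] by simp

lemma algebraic_mult: "Polynomial.algebraic x \<Longrightarrow> Polynomial.algebraic y \<Longrightarrow> Polynomial.algebraic (x * y :: complex)"
  using subringE(6)[OF subfieldE(1)[OF subfield_algebraic], of x y] by simp

lemma algebraic_of_rat [simp]: "Polynomial.algebraic (of_rat q :: complex)"
  by (rule rat_imp_algebraic) simp

lemma simple_extension_Rats: "CC.simple_extension \<rat> z = adj z"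
proof -
  have "CC.simple_extension \<rat> z = (\<lambda>p. CC.eval p z) ` carrier (\<rat>[X]\<^bsub>CC\<^esub>)"
    by (rule CC.simple_extension_as_eval_img) auto
  also have "\<dots> = (\<lambda>p. CC.eval p z) ` range rat_list"
    by (rule arg_cong2[of _ _ _ _ image], rule refl) (auto elim: rat_list_surj intro: rat_list_carrier)
  also have "\<dots> = adj z"
    by (simp add: adj_def image_image eval_rat_list)
  finally show ?thesis .
qed

text \<open>HOL-Algebra gives the dimension as the degree of its own minimal polynomial
  \<open>Irr\<close>. Each of f and \<open>Irr\<close> kills z and so is divisible by the other;
  hence the degrees agree.\<close>

lemma dim_adj:
  assumes "minpoly_of f z"
  shows "ring.dim CC \<rat> (adj z) = Polynomial.degree f"
proof -
  have alg: "(CC.algebraic over \<rat>) z"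
    using minpoly_ofD[OF assms] algebraic_iff_rpoly CC_algebraic_iff by blast
  note Irr = CC.IrrE[OF subfield_Rats _ alg, simplified]
  obtain h where h: "CC.Irr \<rat> z = rat_list h"
    using rat_list_surj Irr(1) by metis
  have "f dvd h"
    using Irr(4) minpoly_ofD(4)[OF assms] by (simp add: h eval_rat_list)
  moreover have "h \<noteq> 0"
    using Irr(2) unfolding h ring_irreducible_def
    by (auto simp: univ_poly_zero rat_list_def)
  ultimately have "Polynomial.degree f \<le> Polynomial.degree h"
    by (rule dvd_imp_degree_le)
  moreover have "Polynomial.degree h \<le> Polynomial.degree f"
  proof -
    have "rat_list h pdivides\<^bsub>CC\<^esub> rat_list f"
      using CC.Irr_minimal[OF subfield_Rats _ alg rat_list_carrier, of f] minpoly_ofD(3)[OF assms]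
      by (simp add: eval_rat_list h)
    hence "length (rat_list h) - 1 \<le> length (rat_list f) - 1"
      using CC.pdivides_imp_degree_le[OF subfieldE(1)[OF subfield_Rats]] rat_list_carrier
        minpoly_ofD(2)[OF assms] by (simp add: rat_list_eq_Nil_iff)
    thus ?thesis
      by (simp only: length_rat_list)
  qed
  ultimately show ?thesis
    using CC.simple_extension_dim[OF subfield_Rats _ alg]
    by (simp add: simple_extension_Rats h over_def length_rat_list[unfolded One_nat_def])
qed

section \<open>Polynomials with coefficients in Q(z), and the primitive element theorem\<close>

definition polys_over :: "complex set \<Rightarrow> complex poly set" where
  "polys_over R = {P. \<forall>i. Polynomial.coeff P i \<in> R}"

lemma adj_sum: "(\<And>i. i \<in> A \<Longrightarrow> h i \<in> adj z) \<Longrightarrow> sum h A \<in> adj z"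
  using adj_of_rat[of 0 z] by (induction A rule: infinite_finite_induct) (auto intro: adj_add)

lemma polys_over_add: "P \<in> polys_over (adj z) \<Longrightarrow> Q \<in> polys_over (adj z) \<Longrightarrow> P + Q \<in> polys_over (adj z)"
  by (auto simp: polys_over_def intro: adj_add)

lemma polys_over_uminus: "P \<in> polys_over (adj z) \<Longrightarrow> - P \<in> polys_over (adj z)"
  by (auto simp: polys_over_def intro: adj_uminus)

lemma polys_over_diff: "P \<in> polys_over (adj z) \<Longrightarrow> Q \<in> polys_over (adj z) \<Longrightarrow> P - Q \<in> polys_over (adj z)"
  using polys_over_add[of P z "-Q"] polys_over_uminus[of Q z] by simp

lemma polys_over_mult: "P \<in> polys_over (adj z) \<Longrightarrow> Q \<in> polys_over (adj z) \<Longrightarrow> P * Q \<in> polys_over (adj z)"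
  by (auto simp: polys_over_def coeff_mult intro!: adj_sum adj_mult)

lemma polys_over_0: "0 \<in> polys_over (adj z)"
  using adj_of_rat[of 0 z] by (auto simp: polys_over_def)

lemma polys_over_pCons_iff: "pCons a P \<in> polys_over R \<longleftrightarrow> a \<in> R \<and> P \<in> polys_over R"
  by (auto simp: polys_over_def coeff_pCons split: nat.splits)

lemma polys_over_pCons: "a \<in> adj z \<Longrightarrow> P \<in> polys_over (adj z) \<Longrightarrow> pCons a P \<in> polys_over (adj z)"
  by (simp add: polys_over_pCons_iff)

lemma polys_over_monom: "a \<in> adj z \<Longrightarrow> Polynomial.monom a n \<in> polys_over (adj z)"
  using adj_of_rat[of 0 z] by (auto simp: polys_over_def)

lemma polys_over_of_rat: "map_poly of_rat g \<in> polys_over (adj z)"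
  by (auto simp: polys_over_def coeff_map_poly adj_of_rat)

lemma polys_over_pcompose:
  assumes "P \<in> polys_over (adj z)" "Q \<in> polys_over (adj z)"
  shows "pcompose P Q \<in> polys_over (adj z)"
  using assms(1)
proof (induction P)
  case 0
  thus ?case by (simp add: polys_over_0)
next
  case (pCons a P)
  have "a \<in> adj z" "P \<in> polys_over (adj z)"
    using pCons.prems by (auto simp: polys_over_pCons_iff)
  thus ?case
    unfolding pcompose_pCons
    by (intro polys_over_add polys_over_mult polys_over_pCons polys_over_0 assms(2) pCons.IH)
qed

text \<open>The minimal polynomial of b over the field \<open>adj z\<close>. Membership of the
  coefficients in \<open>adj z\<close> has to be tracked, so division by m is done by cancelling
  leading terms, with induction on the degree.\<close>

lemma minimal_annihilator_over_adj:
  assumes z: "Polynomial.algebraic z" and ex: "P \<in> polys_over (adj z)" "P \<noteq> 0" "poly P b = 0"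
  obtains m where "m \<in> polys_over (adj z)" "Polynomial.lead_coeff m = 1" "poly m b = 0"
    "\<And>Q. Q \<in> polys_over (adj z) \<Longrightarrow> poly Q b = 0 \<Longrightarrow> m dvd Q"
proof -
  define S where "S Q \<longleftrightarrow> Q \<in> polys_over (adj z) \<and> Q \<noteq> 0 \<and> poly Q b = 0" for Q
  define m0 where "m0 = (ARG_MIN Polynomial.degree Q. S Q)"
  have "S P"
    using ex by (simp add: S_def)
  hence m0: "m0 \<in> polys_over (adj z)" "m0 \<noteq> 0" "poly m0 b = 0"
    using arg_min_natI[of S] unfolding m0_def S_def by blast+
  have m0_min: "Polynomial.degree m0 \<le> Polynomial.degree Q" if "S Q" for Q
    using arg_min_nat_le[of S Q Polynomial.degree] that unfolding m0_def by blast
  define m where "m = Polynomial.smult (inverse (Polynomial.lead_coeff m0)) m0"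
  have "inverse (Polynomial.lead_coeff m0) \<in> adj z"
    using m0(1) adj_inverse[OF z] by (auto simp: polys_over_def)
  hence m: "m \<in> polys_over (adj z)"
    using m0(1) by (auto simp: m_def polys_over_def intro: adj_mult)
  have lc: "Polynomial.lead_coeff m = 1" and mb: "poly m b = 0"
    and deg: "Polynomial.degree m = Polynomial.degree m0"
    using m0 by (auto simp: m_def)
  have "m dvd Q" if "Q \<in> polys_over (adj z)" "poly Q b = 0" for Q
    using that
  proof (induction "Polynomial.degree Q" arbitrary: Q rule: less_induct)
    case less
    show ?case
    proof (cases "Q = 0")
      case False
      hence le: "Polynomial.degree m \<le> Polynomial.degree Q"
        using m0_min less.prems deg by (simp add: S_def)
      \<comment> \<open>The multiple of m with the same leading term as Q. Here m is monic, so its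
        leading coefficient needs no inversion.\<close>
      define T where "T = Polynomial.monom (Polynomial.lead_coeff Q) (Polynomial.degree Q - Polynomial.degree m) * m"
      have "T \<in> polys_over (adj z)"
        unfolding T_def using less.prems(1)
        by (intro polys_over_mult polys_over_monom m) (auto simp: polys_over_def)
      hence QT: "Q - T \<in> polys_over (adj z)" "poly (Q - T) b = 0"
        using less.prems mb by (auto intro: polys_over_diff simp: T_def)
      have degT: "Polynomial.degree T \<le> Polynomial.degree Q"
        unfolding T_def using degree_mult_le[of "Polynomial.monom (Polynomial.lead_coeff Q) (Polynomial.degree Q - Polynomial.degree m)" m]
          degree_monom_le[of "Polynomial.lead_coeff Q" "Polynomial.degree Q - Polynomial.degree m"] le
        by linarith
      have "Polynomial.coeff (Q - T) (Polynomial.degree Q) = 0"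
        using le lc by (simp add: T_def coeff_monom_mult)
      hence "Q - T = 0 \<or> Polynomial.degree (Q - T) < Polynomial.degree Q"
        using degT degree_diff_le[of Q "Polynomial.degree Q" T] by (intro eq_zero_or_degree_less) auto
      hence "m dvd Q - T"
        using less.hyps QT by auto
      moreover have "m dvd T"
        by (simp add: T_def)
      ultimately have "m dvd (Q - T) + T"
        by (rule dvd_add)
      thus ?thesis by simp
    qed simp
  qed
  thus ?thesis
    using that m lc mb by blast
qed

text \<open>With t = a + c b, the polynomials g(X) and f(t - c X) over Q(t) both vanish at b. For c
  outside a finite set b is their only common root, and g has no double roots, so the minimal
  polynomial m of b over Q(t), dividing both, is X - b. Hence b and then a lie in Q(t).\<close>

lemma primitive_element_two:
  fixes a b :: complex
  assumes "Polynomial.algebraic a" "Polynomial.algebraic b"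
  obtains c :: rat where "Polynomial.algebraic (a + of_rat c * b)"
    "a \<in> adj (a + of_rat c * b)" "b \<in> adj (a + of_rat c * b)"
proof -
  obtain f where f: "minpoly_of f a"
    using minpoly_of_exists[OF assms(1)] by blast
  obtain g where g: "minpoly_of g b"
    using minpoly_of_exists[OF assms(2)] by blast
  \<comment> \<open>A further common root y of g and f(t - c X), with x = t - c y, would force c =
    (x - a) / (b - y). Pairs with y = b contribute the value 0 of a division by zero, which merely
    excludes c = 0.\<close>
  define bad where "bad = (\<lambda>(x, y). (x - a) / (b - y)) ` ({x. rpoly f x = 0} \<times> {y. rpoly g y = 0})"
  have "finite bad"
    unfolding bad_def using minpoly_ofD(2)[OF f] minpoly_ofD(2)[OF g]
    by (intro finite_imageI finite_cartesian_product finite_rpoly_roots)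
  moreover have "infinite (range (of_rat :: rat \<Rightarrow> complex))"
    using finite_imageD[of "of_rat :: rat \<Rightarrow> complex" UNIV] infinite_UNIV_char_0[where 'a = rat]
    by (auto simp: inj_on_def)
  ultimately have "\<not> range (of_rat :: rat \<Rightarrow> complex) \<subseteq> bad"
    using finite_subset by blast
  then obtain c :: rat where c: "(of_rat c :: complex) \<notin> bad"
    by blast
  define t where "t = a + of_rat c * b"
  have t: "Polynomial.algebraic t"
    unfolding t_def using assms by (intro algebraic_add algebraic_mult) auto
  define G where "G = map_poly (of_rat :: rat \<Rightarrow> complex) g"
  define H where "H = pcompose (map_poly (of_rat :: rat \<Rightarrow> complex) f) [:t, - of_rat c:]"
  have G: "G \<in> polys_over (adj t)" "G \<noteq> 0" "poly G b = 0"
    using minpoly_ofD[OF g] by (auto simp: G_def polys_over_of_rat rpoly_def)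
  have H: "H \<in> polys_over (adj t)"
    unfolding H_def
    by (intro polys_over_pcompose polys_over_of_rat polys_over_pCons polys_over_0 adj_self adj_uminus adj_of_rat)
  have H_eq: "poly H x = rpoly f (t - of_rat c * x)" for x
    by (simp add: H_def poly_pcompose rpoly_def algebra_simps)
  have Hb: "poly H b = 0"
    using minpoly_ofD(3)[OF f] by (simp add: H_eq t_def)
  obtain m where m: "m \<in> polys_over (adj t)" "Polynomial.lead_coeff m = 1" "poly m b = 0"
    and dvd: "\<And>Q. Q \<in> polys_over (adj t) \<Longrightarrow> poly Q b = 0 \<Longrightarrow> m dvd Q"
    using minimal_annihilator_over_adj[OF t G] by metis
  have mG: "m dvd G" and mH: "m dvd H"
    using dvd G H Hb by auto
  have root: "x = b" if "poly m x = 0" for x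
  proof (rule ccontr)
    assume "x \<noteq> b"
    have "poly G x = 0" "poly H x = 0"
      using that mG mH by (auto elim!: dvdE)
    hence "rpoly g x = 0" "rpoly f (t - of_rat c * x) = 0"
      by (simp add: G_def rpoly_def) (use \<open>poly H x = 0\<close> H_eq in simp)
    hence "((t - of_rat c * x) - a) / (b - x) \<in> bad"
      unfolding bad_def by (intro image_eqI[of _ _ "(t - of_rat c * x, x)"]) auto
    moreover have "((t - of_rat c * x) - a) / (b - x) = of_rat c"
      using \<open>x \<noteq> b\<close> by (simp add: t_def field_simps)
    ultimately show False
      using c by simp
  qed
  have "rsquarefree m"
    unfolding rsquarefree_roots
  proof safe
    fix x assume x: "poly m x = 0" "poly (pderiv m) x = 0"
    obtain k where k: "G = m * k"
      using mG by (rule dvdE)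
    have "poly G x = 0" "poly (pderiv G) x = 0"
      using x by (auto simp: k pderiv_mult)
    thus False
      using minpoly_of_rsquarefree[OF g] unfolding rsquarefree_roots G_def by blast
  qed
  hence m_eq: "m = (\<Prod>x | poly m x = 0. [:- x, 1:])"
    using complex_poly_decompose_rsquarefree[of m] m(2) by simp
  have "{x. poly m x = 0} = {b}"
    using root m(3) by blast
  hence "m = [:- b, 1:]"
    using m_eq by simp
  \<comment> \<open>Read off from the constant coefficient of m.\<close>
  hence "- b \<in> adj t"
    using m(1) by (auto simp: polys_over_def dest: spec[of _ 0])
  hence b: "b \<in> adj t"
    using adj_uminus by fastforce
  hence "t + - (of_rat c * b) \<in> adj t"
    by (intro adj_add adj_self adj_uminus adj_mult adj_of_rat)
  hence "a \<in> adj t"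
    by (simp add: t_def)
  with b t show ?thesis
    using that unfolding t_def by blast
qed

text \<open>The last conclusion says that t lies in the rational span of S, expressed by closure
  under x + q y. It is what puts t inside a given number field containing S.\<close>

lemma primitive_element:
  assumes "finite S" "\<And>x. x \<in> S \<Longrightarrow> Polynomial.algebraic (x :: complex)"
  obtains t where "Polynomial.algebraic t" "S \<subseteq> adj t"
    "\<And>R. 0 \<in> R \<Longrightarrow> (\<And>x y q. x \<in> R \<Longrightarrow> y \<in> R \<Longrightarrow> x + of_rat q * y \<in> R) \<Longrightarrow> S \<subseteq> R \<Longrightarrow> t \<in> R"
proof -
  have "\<exists>t. Polynomial.algebraic t \<and> S \<subseteq> adj t \<and>
    (\<forall>R. 0 \<in> R \<longrightarrow> (\<forall>x\<in>R. \<forall>y\<in>R. \<forall>q. x + of_rat q * y \<in> R) \<longrightarrow> S \<subseteq> R \<longrightarrow> t \<in> R)"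
    using assms
  proof (induction rule: finite_induct)
    case empty
    show ?case by (rule exI[of _ 0]) auto
  next
    case (insert b S)
    then obtain a where a: "Polynomial.algebraic a" "S \<subseteq> adj a"
      and R: "\<And>R. 0 \<in> R \<Longrightarrow> \<forall>x\<in>R. \<forall>y\<in>R. \<forall>q. x + of_rat q * y \<in> R \<Longrightarrow> S \<subseteq> R \<Longrightarrow> a \<in> R"
      by auto
    have "Polynomial.algebraic b"
      using insert.prems by blast
    then obtain c :: rat where c: "Polynomial.algebraic (a + of_rat c * b)"
      "a \<in> adj (a + of_rat c * b)" "b \<in> adj (a + of_rat c * b)"
      using primitive_element_two[OF a(1)] by blast
    have "S \<subseteq> adj (a + of_rat c * b)"
      using a(2) adj_rpoly[OF c(2)] by (auto elim!: adjE)
    thus ?case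
      using c R by (intro exI[of _ "a + of_rat c * b"]) auto
  qed
  then obtain t where t: "Polynomial.algebraic t" "S \<subseteq> adj t"
    "\<forall>R. 0 \<in> R \<longrightarrow> (\<forall>x\<in>R. \<forall>y\<in>R. \<forall>q. x + of_rat q * y \<in> R) \<longrightarrow> S \<subseteq> R \<longrightarrow> t \<in> R"
    by blast
  show ?thesis
    by (rule that[OF t(1,2)]) (use t(3) in simp)
qed

text \<open>A primitive element t for a finite rational basis of K lies in the span of the basis,
  hence in K; conversely that span lies in \<open>adj t\<close>, since the basis does.\<close>

lemma number_field_adj:
  assumes "number_field K"
  obtains t where "Polynomial.algebraic t" "K = adj t"
proof -
  have K: "subfield K CC" "CC.finite_dimension \<rat> K"
    using assms by (auto simp: number_field_def)
  note Kring = subringE[OF subfieldE(1)[OF K(1)], simplified]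
  have alg: "Polynomial.algebraic x" if "x \<in> K" for x
    using CC.finite_dimension_imp_algebraic[OF subfield_Rats subfieldE(1)[OF K(1)] K(2) that]
    by (simp add: CC_algebraic_iff)
  have "of_nat n \<in> K" for n
    by (induction n) (use Kring in auto)
  moreover have "inverse x \<in> K" if "x \<in> K" for x
    using CC.subfield_m_inv(1)[OF K(1), of x] that by (cases "x = 0") auto
  moreover have "- x \<in> K" if "x \<in> K" for x
    using Kring that by auto
  ultimately have "of_int n \<in> K" for n
    by (cases n) (auto simp del: of_nat_Suc)
  have rat: "of_rat q \<in> K" for q
  proof (cases q)
    case (Fract a b)
    have "of_int a * inverse (of_int b) \<in> K"
      using \<open>\<And>n. of_int n \<in> K\<close> \<open>\<And>x. x \<in> K \<Longrightarrow> inverse x \<in> K\<close> Kring by auto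
    thus ?thesis
      using Fract by (simp add: of_rat_rat divide_inverse)
  qed
  obtain n where "CC.dimension n \<rat> K"
    using K(2) by blast
  then obtain Us where Us: "CC.Span \<rat> Us = K"
    using CC.exists_base[OF subfield_Rats] by blast
  have Us_K: "set Us \<subseteq> K"
    using CC.Span_base_incl[OF subfield_Rats, of Us] Us by auto
  obtain t where t: "Polynomial.algebraic t" "set Us \<subseteq> adj t"
    and tR: "\<And>R. 0 \<in> R \<Longrightarrow> (\<And>x y q. x \<in> R \<Longrightarrow> y \<in> R \<Longrightarrow> x + of_rat q * y \<in> R) \<Longrightarrow> set Us \<subseteq> R \<Longrightarrow> t \<in> R"
    using primitive_element[of "set Us"] alg Us_K by (metis List.finite_set subsetD)
  have "t \<in> K"
    using Kring rat Us_K by (intro tR) auto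
  have rpoly_K: "rpoly g t \<in> K" for g
    by (induction g) (use Kring rat \<open>t \<in> K\<close> in auto)
  have "CC.Span \<rat> Vs \<subseteq> adj t" if "set Vs \<subseteq> adj t" for Vs
    using that
  proof (induction Vs)
    case Nil
    thus ?case using adj_of_rat[of 0 t] by simp
  next
    case (Cons v Vs)
    show ?case
    proof
      fix u assume "u \<in> CC.Span \<rat> (v # Vs)"
      then obtain k w where "k \<in> \<rat>" "w \<in> CC.Span \<rat> Vs" "u = k * v + w"
        using CC.line_extension_mem_iff[of u \<rat> v "CC.Span \<rat> Vs"] by auto
      thus "u \<in> adj t"
        using Cons by (auto elim!: Rats_cases intro!: adj_add adj_mult adj_of_rat)
    qed
  qed
  hence "K = adj t"
    using Us t(2) rpoly_K by (auto elim: adjE)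
  with t show ?thesis
    using that by blast
qed

section \<open>Embeddings of number fields\<close>

text \<open>The source is a subset of a type-class ring and the target a HOL-Algebra field. One
  notion thus covers maps from the rationals and from Q(z), both into C_p and into the complex
  numbers viewed as \<open>CC\<close>.\<close>

locale hom_on = field L for L :: "'c ring" (structure) +
  fixes S :: "'a::comm_ring_1 set" and \<phi> :: "'a \<Rightarrow> 'c"
  assumes S_0: "0 \<in> S" and S_1: "1 \<in> S"
    and S_add: "x \<in> S \<Longrightarrow> y \<in> S \<Longrightarrow> x + y \<in> S"
    and S_mult: "x \<in> S \<Longrightarrow> y \<in> S \<Longrightarrow> x * y \<in> S"
    and S_uminus: "x \<in> S \<Longrightarrow> - x \<in> S"
    and closed [simp, intro]: "x \<in> S \<Longrightarrow> \<phi> x \<in> carrier L"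
    and add: "x \<in> S \<Longrightarrow> y \<in> S \<Longrightarrow> \<phi> (x + y) = \<phi> x \<oplus> \<phi> y"
    and mult: "x \<in> S \<Longrightarrow> y \<in> S \<Longrightarrow> \<phi> (x * y) = \<phi> x \<otimes> \<phi> y"
    and one: "\<phi> 1 = \<one>"
begin

lemma zero: "\<phi> 0 = \<zero>"
proof -
  have "\<phi> 0 \<oplus> \<phi> 0 = \<phi> 0 \<oplus> \<zero>"
    using add[of 0 0] S_0 by simp
  thus ?thesis
    using S_0 by (metis add.l_cancel closed zero_closed)
qed

lemma uminus: "x \<in> S \<Longrightarrow> \<phi> (- x) = \<ominus> \<phi> x"
  using add[of "- x" x] by (metis S_uminus ab_left_minus closed minus_equality zero)

text \<open>The image polynomial under \<phi>, evaluated at y by Horner's rule, so that polynomials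
  over L need not be formed.\<close>

definition ev :: "'a poly \<Rightarrow> 'c \<Rightarrow> 'c" where
  "ev P y = fold_coeffs (\<lambda>a s. \<phi> a \<oplus> y \<otimes> s) P \<zero>"

definition coeffs_in :: "'a poly \<Rightarrow> bool" where
  "coeffs_in P \<longleftrightarrow> (\<forall>i. Polynomial.coeff P i \<in> S)"

lemma coeffs_in_0 [simp]: "coeffs_in 0"
  by (simp add: coeffs_in_def S_0)

lemma coeffs_in_pCons [simp]: "coeffs_in (pCons a P) \<longleftrightarrow> a \<in> S \<and> coeffs_in P"
  unfolding coeffs_in_def by (auto simp: coeff_pCons split: nat.splits)

lemma coeffs_in_add: "coeffs_in P \<Longrightarrow> coeffs_in Q \<Longrightarrow> coeffs_in (P + Q)"
  by (simp add: coeffs_in_def S_add)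

lemma coeffs_in_smult: "a \<in> S \<Longrightarrow> coeffs_in P \<Longrightarrow> coeffs_in (Polynomial.smult a P)"
  by (simp add: coeffs_in_def S_mult)

lemma coeffs_in_mult:
  assumes "coeffs_in P" "coeffs_in Q"
  shows "coeffs_in (P * Q)"
  using assms(1) by (induction P) (auto simp: assms(2) S_0 intro!: coeffs_in_add coeffs_in_smult)

lemma ev_0 [simp]: "ev 0 y = \<zero>"
  by (simp add: ev_def)

context
  fixes y
  assumes y [simp]: "y \<in> carrier L"
begin

lemma ev_pCons [simp]: "ev (pCons a P) y = \<phi> a \<oplus> y \<otimes> ev P y"
  by (cases "a = 0 \<and> P = 0") (auto simp: ev_def zero)

lemma ev_closed [simp, intro]: "coeffs_in P \<Longrightarrow> ev P y \<in> carrier L"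
  by (induction P) auto

lemma ev_add: "coeffs_in P \<Longrightarrow> coeffs_in Q \<Longrightarrow> ev (P + Q) y = ev P y \<oplus> ev Q y"
  by (induction P Q rule: poly_induct2) (auto simp: add r_distr a_ac)

lemma ev_smult: "a \<in> S \<Longrightarrow> coeffs_in P \<Longrightarrow> ev (Polynomial.smult a P) y = \<phi> a \<otimes> ev P y"
  by (induction P) (auto simp: mult r_distr m_ac)

lemma ev_mult:
  assumes "coeffs_in P" "coeffs_in Q"
  shows "ev (P * Q) y = ev P y \<otimes> ev Q y"
  using assms(1)
proof (induction P)
  case 0
  thus ?case using assms(2) by simp
next
  case (pCons a P)
  hence *: "a \<in> S" "coeffs_in P"
    by auto
  have "ev (pCons a P * Q) y = ev (Polynomial.smult a Q) y \<oplus> ev (pCons 0 (P * Q)) y"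
    using * assms(2) by (subst ev_add [symmetric]) (auto simp: S_0 intro: coeffs_in_smult coeffs_in_mult)
  also have "\<dots> = ev (pCons a P) y \<otimes> ev Q y"
    using * assms(2) pCons.IH by (simp add: ev_smult zero l_distr m_assoc coeffs_in_mult)
  finally show ?case .
qed

text \<open>L is a domain, so a zero of a product is a zero of a factor. For a polynomial that
  splits over S this says that all roots of its image in L come from S.\<close>

lemma ev_prod_linear_eq_0:
  assumes "finite A" "A \<subseteq> S" "ev (\<Prod>w\<in>A. [:- w, 1:]) y = \<zero>"
  shows "\<exists>w\<in>A. y = \<phi> w"
  using assms
proof (induction rule: finite_induct)
  case empty
  thus ?case by (simp add: one_pCons one)
next
  case (insert w A)
  have lin: "coeffs_in [:- x, 1:]" if "x \<in> S" for x
    using that S_1 S_uminus by simp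
  have prod: "coeffs_in (\<Prod>w\<in>B. [:- w, 1:])" if "B \<subseteq> S" "finite B" for B
    using that(2,1) by (induction rule: finite_induct) (auto simp: one_pCons S_1 S_uminus intro!: coeffs_in_mult simp del: mult_pCons_left mult_pCons_right)
  have w: "w \<in> S" "A \<subseteq> S"
    using insert.prems by auto
  have "ev (\<Prod>w\<in>insert w A. [:- w, 1:]) y = ev [:- w, 1:] y \<otimes> ev (\<Prod>w\<in>A. [:- w, 1:]) y"
    unfolding prod.insert[OF insert.hyps] using w lin prod insert.hyps by (intro ev_mult) auto
  hence "ev [:- w, 1:] y = \<zero> \<or> ev (\<Prod>w\<in>A. [:- w, 1:]) y = \<zero>"
    using insert.prems(2) integral[of "ev [:- w, 1:] y" "ev (\<Prod>w\<in>A. [:- w, 1:]) y"] ev_closed lin prod w insert.hyps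
    by auto
  thus ?case
  proof
    assume "ev [:- w, 1:] y = \<zero>"
    hence "\<ominus> \<phi> w \<oplus> y = \<zero>"
      using w by (simp add: uminus one)
    hence "y = \<phi> w"
      using w by (metis add.inv_solve_left closed minus_minus minus_equality a_comm a_inv_closed y)
    thus ?thesis by blast
  qed (use insert.IH w in blast)
qed

end

end

text \<open>Determined on integers by additivity, then on fractions by clearing denominators. It
  lets any embedding be exchanged with \<open>of_rat\<close> or \<open>rat_embed\<close> on rational
  numbers.\<close>

lemma hom_on_rat_unique:
  fixes L :: "'c ring" (structure) and \<rho>1 \<rho>2 :: "rat \<Rightarrow> 'c"
  assumes "hom_on L UNIV \<rho>1" "hom_on L UNIV \<rho>2"
  shows "\<rho>1 = \<rho>2"
proof
  interpret h1: hom_on L UNIV \<rho>1 by fact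
  interpret h2: hom_on L UNIV \<rho>2 by fact
  have nat: "\<rho>1 (of_nat n) = \<rho>2 (of_nat n)" for n
    by (induction n) (simp_all add: h1.zero h2.zero h1.add h2.add h1.one h2.one)
  have int: "\<rho>1 (of_int n) = \<rho>2 (of_int n)" for n
    by (cases n) (simp_all add: nat h1.uminus h2.uminus del: of_nat_Suc)
  fix q :: rat
  show "\<rho>1 q = \<rho>2 q"
  proof (cases q)
    case (Fract a b)
    have b: "(of_int b :: rat) \<noteq> 0"
      using Fract by simp
    have q: "q * of_int b = of_int a"
      using Fract by (simp add: Fract_of_int_quotient)
    have "\<rho>1 (of_int b) \<otimes> \<rho>1 (inverse (of_int b)) = \<one>"
      using b by (simp add: h1.one flip: h1.mult)
    hence nz: "\<rho>1 (of_int b) \<noteq> \<zero>"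
      by auto
    have "\<rho>1 q \<otimes> \<rho>1 (of_int b) = \<rho>2 q \<otimes> \<rho>1 (of_int b)"
      using h1.mult[of q "of_int b"] h2.mult[of q "of_int b"] q by (simp add: int)
    thus ?thesis
      using nz h1.m_rcancel by auto
  qed
qed

section \<open>Embeddings of Q(z) into an arbitrary field\<close>

lemma embeddingsI:
  assumes "\<And>x. x \<in> K \<Longrightarrow> \<sigma> x \<in> carrier L"
    "\<And>x y. x \<in> K \<Longrightarrow> y \<in> K \<Longrightarrow> \<sigma> (x + y) = \<sigma> x \<oplus>\<^bsub>L\<^esub> \<sigma> y"
    "\<And>x y. x \<in> K \<Longrightarrow> y \<in> K \<Longrightarrow> \<sigma> (x * y) = \<sigma> x \<otimes>\<^bsub>L\<^esub> \<sigma> y"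
    "\<sigma> 1 = \<one>\<^bsub>L\<^esub>" "\<sigma> \<in> extensional K"
  shows "\<sigma> \<in> embeddings K L"
  using assms by (auto simp: embeddings_def ring_hom_def)

lemma hom_on_embedding:
  assumes "field L" "\<sigma> \<in> embeddings (adj z) L"
  shows "hom_on L (adj z) \<sigma>"
proof -
  have "0 \<in> adj z" "1 \<in> adj z"
    using adj_of_rat[of 0 z] adj_of_rat[of 1 z] by auto
  thus ?thesis
    using assms unfolding embeddings_def ring_hom_def hom_on_def hom_on_axioms_def
    by (auto intro: adj_add adj_mult adj_uminus)
qed

lemma hom_on_rat_restrict:
  assumes "hom_on L (adj z) \<sigma>"
  shows "hom_on L UNIV (\<lambda>q::rat. \<sigma> (of_rat q))"
proof -
  interpret hom_on L "adj z" \<sigma> by fact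
  show ?thesis
    by unfold_locales (auto simp: adj_of_rat add mult one of_rat_add of_rat_mult)
qed

lemma embedding_rpoly:
  assumes "hom_on L (adj z) \<sigma>" "hom_on L UNIV \<rho>" "x \<in> adj z"
  shows "\<sigma> (rpoly g x) = hom_on.ev L \<rho> g (\<sigma> x)"
proof -
  interpret s: hom_on L "adj z" \<sigma> by fact
  interpret r: hom_on L UNIV \<rho> by fact
  have *: "\<sigma> (of_rat q) = \<rho> q" for q
    using hom_on_rat_unique[OF hom_on_rat_restrict[OF assms(1)] assms(2)] by (rule fun_cong)
  show ?thesis
    by (induction g)
       (use assms(3) in \<open>simp_all add: s.zero s.add s.mult * adj_of_rat adj_mult adj_rpoly\<close>)
qed

text \<open>Q(z) is Q[X]/(f), so g(z) may be sent to g(r) as soon as f(r) = 0.\<close>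

lemma embedding_exists:
  fixes L :: "'c ring" (structure)
  assumes f: "minpoly_of f z" and \<rho>: "hom_on L UNIV \<rho>"
    and r: "r \<in> carrier L" "hom_on.ev L \<rho> f r = \<zero>"
  obtains \<sigma> where "\<sigma> \<in> embeddings (adj z) L" "\<sigma> z = r"
proof -
  interpret hom_on L UNIV \<rho> by fact
  have [simp]: "coeffs_in g" for g
    by (simp add: coeffs_in_def)
  have cong: "ev g r = ev h r" if "rpoly g z = rpoly h z" for g h
  proof -
    have "f dvd g - h"
      using that minpoly_ofD(4)[OF f, of "g - h"] by simp
    then obtain k where "g - h = f * k"
      by (rule dvdE)
    hence "g = h + f * k"
      by (simp add: algebra_simps)
    thus ?thesis
      using r by (simp add: ev_add ev_mult)
  qed
  \<comment> \<open>An arbitrary polynomial representing x is chosen; by \<open>cong\<close> the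
    value at r does not depend on it.\<close>
  define \<sigma> where "\<sigma> = restrict (\<lambda>x. ev (SOME g. rpoly g z = x) r) (adj z)"
  have \<sigma>: "\<sigma> (rpoly g z) = ev g r" for g
    unfolding \<sigma>_def by (simp add: adjI) (rule cong, rule someI, rule refl)
  have "\<sigma> \<in> embeddings (adj z) L"
  proof (rule embeddingsI)
    fix x y assume "x \<in> adj z" "y \<in> adj z"
    then obtain g h where gh: "x = rpoly g z" "y = rpoly h z"
      by (auto elim!: adjE)
    show "\<sigma> x \<in> carrier L"
      using r(1) by (simp add: gh \<sigma>)
    show "\<sigma> (x + y) = \<sigma> x \<oplus> \<sigma> y"
      using r(1) \<sigma>[of "g + h"] by (simp add: gh \<sigma> ev_add)
    show "\<sigma> (x * y) = \<sigma> x \<otimes> \<sigma> y"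
      using r(1) \<sigma>[of "g * h"] by (simp add: gh \<sigma> ev_mult)
  next
    show "\<sigma> 1 = \<one>"
      using r(1) \<sigma>[of 1] by (simp add: one_pCons one)
  qed (auto simp: \<sigma>_def)
  moreover have "\<sigma> z = r"
    using \<sigma>[of "[:0, 1:]"] r(1) by (simp add: zero one)
  ultimately show ?thesis
    by (rule that)
qed

lemma embedding_eqI:
  assumes "field L" "\<sigma> \<in> embeddings (adj z) L" "\<tau> \<in> embeddings (adj z) L" "\<sigma> z = \<tau> z"
  shows "\<sigma> = \<tau>"
proof (rule extensionalityI)
  show "\<sigma> \<in> extensional (adj z)" "\<tau> \<in> extensional (adj z)"
    using assms by (auto simp: embeddings_def)
  fix x assume "x \<in> adj z"
  then obtain g where g: "x = rpoly g z"
    by (rule adjE)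
  note h = hom_on_embedding[OF assms(1)]
  show "\<sigma> x = \<tau> x"
    unfolding g
    using embedding_rpoly[OF h[OF assms(2)] hom_on_rat_restrict[OF h[OF assms(2)]] adj_self, of g]
      embedding_rpoly[OF h[OF assms(3)] hom_on_rat_restrict[OF h[OF assms(2)]] adj_self, of g] assms(4)
    by simp
qed

lemma hom_on_CC_of_rat: "hom_on CC UNIV (of_rat :: rat \<Rightarrow> complex)"
  by (intro hom_on.intro field_from_type_algebra hom_on_axioms.intro) (auto simp: of_rat_add of_rat_mult)

lemma hom_on_CC_ev: "hom_on.ev CC (of_rat :: rat \<Rightarrow> complex) g y = rpoly g y"
proof -
  interpret hom_on CC UNIV "of_rat :: rat \<Rightarrow> complex"
    by (rule hom_on_CC_of_rat)
  show ?thesis by (induction g) auto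
qed

lemma hom_on_CC: "\<tau> \<in> embeddings (adj z) CC \<Longrightarrow> hom_on CC (adj z) \<tau>"
  by (rule hom_on_embedding[OF field_from_type_algebra])

lemma embedding_CC_rpoly:
  "\<tau> \<in> embeddings (adj z) CC \<Longrightarrow> x \<in> adj z \<Longrightarrow> \<tau> (rpoly g x) = rpoly g (\<tau> x)"
  using embedding_rpoly[OF hom_on_CC hom_on_CC_of_rat] by (simp add: hom_on_CC_ev)

lemma embedding_CC_root:
  assumes "minpoly_of f z" "\<tau> \<in> embeddings (adj z) CC"
  shows "rpoly f (\<tau> z) = 0"
proof -
  interpret hom_on CC "adj z" \<tau>
    by (rule hom_on_CC) fact
  show ?thesis
    using embedding_CC_rpoly[OF assms(2) adj_self, of f] minpoly_ofD(3)[OF assms(1)] zero by simp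
qed

lemma embeddings_CC_bij:
  assumes f: "minpoly_of f z"
  shows "bij_betw (\<lambda>\<tau>. \<tau> z) (embeddings (adj z) CC) {w. rpoly f w = 0}"
proof (rule bij_betwI')
  fix w assume "w \<in> {w. rpoly f w = 0}"
  hence "w \<in> carrier CC" "hom_on.ev CC of_rat f w = \<zero>\<^bsub>CC\<^esub>"
    by (auto simp: hom_on_CC_ev)
  from embedding_exists[OF f hom_on_CC_of_rat this]
  show "\<exists>\<tau>\<in>embeddings (adj z) CC. w = \<tau> z"
    by metis
qed (use embedding_CC_root[OF f] embedding_eqI[OF field_from_type_algebra] in auto)

lemma card_embeddings_CC:
  assumes "Polynomial.algebraic z"
  shows "finite (embeddings (adj z) CC)"
    "card (embeddings (adj z) CC) = ring.dim CC \<rat> (adj z)" "ring.dim CC \<rat> (adj z) > 0"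
proof -
  obtain f where f: "minpoly_of f z"
    using minpoly_of_exists[OF assms] by blast
  note bij = embeddings_CC_bij[OF f]
  show "finite (embeddings (adj z) CC)"
    using bij_betw_finite[OF bij] finite_rpoly_roots minpoly_ofD(2)[OF f] by blast
  show "card (embeddings (adj z) CC) = ring.dim CC \<rat> (adj z)"
    using bij_betw_same_card[OF bij] card_rpoly_roots[OF f] dim_adj[OF f] by simp
  show "ring.dim CC \<rat> (adj z) > 0"
    using dim_adj[OF f] minpoly_of_degree_pos[OF f] by simp
qed

text \<open>Any \<sigma> into L sends z to a root of f. As f splits over \<open>adj t\<close>,
  applying \<iota> to its factorization shows that this root is \<iota> w for a complex root w, and
  w determines the complex embedding through which \<sigma> factors. It is used with L = C_p to
  compare places, and with L the complex numbers to see that composition with an embedding of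
  \<open>adj t\<close> permutes the embeddings of \<open>adj z\<close> up to the choice of
  restriction.\<close>

lemma embeddings_factor:
  assumes t: "Polynomial.algebraic t" and f: "minpoly_of f z" and L: "field L"
    and \<iota>: "\<iota> \<in> embeddings (adj t) L" and roots: "{w. rpoly f w = 0} \<subseteq> adj t"
  shows "bij_betw (\<lambda>\<tau>. restrict (\<iota> \<circ> \<tau>) (adj z)) (embeddings (adj z) CC) (embeddings (adj z) L)"
    and "\<tau> \<in> embeddings (adj z) CC \<Longrightarrow> x \<in> adj z \<Longrightarrow> \<tau> x \<in> adj t"
proof -
  interpret i: hom_on L "adj t" \<iota>
    using hom_on_embedding[OF L \<iota>] .
  have mem: "\<tau> x \<in> adj t" if \<tau>: "\<tau> \<in> embeddings (adj z) CC" and x: "x \<in> adj z" for \<tau> x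
  proof -
    obtain g where g: "x = rpoly g z"
      using x by (rule adjE)
    have "\<tau> z \<in> adj t"
      using embedding_CC_root[OF f \<tau>] roots by blast
    thus ?thesis
      using embedding_CC_rpoly[OF \<tau> adj_self, of g] adj_rpoly by (simp add: g)
  qed
  thus "\<tau> \<in> embeddings (adj z) CC \<Longrightarrow> x \<in> adj z \<Longrightarrow> \<tau> x \<in> adj t" .
  have emb: "restrict (\<iota> \<circ> \<tau>) (adj z) \<in> embeddings (adj z) L" if \<tau>: "\<tau> \<in> embeddings (adj z) CC" for \<tau>
  proof -
    interpret c: hom_on CC "adj z" \<tau>
      using hom_on_CC[OF \<tau>] .
    show ?thesis
      by (rule embeddingsI)
         (use mem[OF \<tau>] c.S_1 in \<open>auto simp: c.S_add c.S_mult c.add c.mult c.one i.add i.mult i.one\<close>)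
  qed
  show "bij_betw (\<lambda>\<tau>. restrict (\<iota> \<circ> \<tau>) (adj z)) (embeddings (adj z) CC) (embeddings (adj z) L)"
  proof (rule bij_betwI')
    fix \<tau> \<tau>' assume \<tau>: "\<tau> \<in> embeddings (adj z) CC" "\<tau>' \<in> embeddings (adj z) CC"
    show "restrict (\<iota> \<circ> \<tau>) (adj z) = restrict (\<iota> \<circ> \<tau>') (adj z) \<longleftrightarrow> \<tau> = \<tau>'"
    proof
      assume "restrict (\<iota> \<circ> \<tau>) (adj z) = restrict (\<iota> \<circ> \<tau>') (adj z)"
      from fun_cong[OF this, of z] have eq: "\<iota> (\<tau> z) = \<iota> (\<tau>' z)"
        by (simp add: adj_self)
      have "\<tau> z = \<tau>' z"
      proof (rule ccontr)
        assume ne: "\<tau> z \<noteq> \<tau>' z"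
        \<comment> \<open>Injectivity of \<iota>: a nonzero d with \<iota> d = 0 would make \<iota>
          (d * inverse d) equal to both 0 and 1.\<close>
        define d where "d = \<tau> z + - \<tau>' z"
        have "d \<in> adj t"
          unfolding d_def by (intro adj_add adj_uminus mem \<tau> adj_self)
        with ne have dt: "d \<in> adj t" "d \<noteq> 0"
          by (simp_all add: d_def)
        have "\<iota> d = \<iota> (\<tau> z) \<oplus>\<^bsub>L\<^esub> \<ominus>\<^bsub>L\<^esub> \<iota> (\<tau>' z)"
          using mem \<tau> adj_self by (simp add: d_def i.add i.uminus adj_uminus del: add_uminus_conv_diff)
        hence "\<iota> d = \<zero>\<^bsub>L\<^esub>"
          using eq mem \<tau> adj_self by (simp add: i.r_neg)
        hence "\<iota> (d * inverse d) = \<zero>\<^bsub>L\<^esub>"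
          using dt adj_inverse[OF t dt(1)] by (subst i.mult) auto
        thus False
          using dt by (simp add: i.one)
      qed
      thus "\<tau> = \<tau>'"
        using embedding_eqI[OF field_from_type_algebra \<tau>] by blast
    qed auto
  next
    fix \<sigma> assume \<sigma>: "\<sigma> \<in> embeddings (adj z) L"
    interpret s: hom_on L "adj z" \<sigma>
      using hom_on_embedding[OF L \<sigma>] .
    define \<rho> where "\<rho> = (\<lambda>q::rat. \<iota> (of_rat q))"
    interpret r: hom_on L UNIV \<rho>
      unfolding \<rho>_def using hom_on_rat_restrict i.hom_on_axioms .
    have \<rho>_eq: "\<iota> (of_rat q) = \<rho> q" for q
      by (simp add: \<rho>_def)
    have y: "\<sigma> z \<in> carrier L"
      using adj_self by auto
    \<comment> \<open>Evaluating f with rational coefficients, or first viewing them in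
      \<open>adj t\<close> and then applying \<iota>, gives the same result; only the second form
      can use the factorization.\<close>
    have ev_eq: "i.ev (map_poly of_rat g) (\<sigma> z) = r.ev g (\<sigma> z)" for g
    proof (induction g)
      case (pCons a g)
      hence "map_poly of_rat (pCons a g) = pCons (of_rat a :: complex) (map_poly of_rat g)"
        by (intro map_poly_pCons) auto
      thus ?case
        using pCons y by (simp add: \<rho>_eq)
    qed simp
    have "\<zero>\<^bsub>L\<^esub> = r.ev f (\<sigma> z)"
      using embedding_rpoly[OF s.hom_on_axioms r.hom_on_axioms adj_self, of f] minpoly_ofD(3)[OF f]
      by (simp add: s.zero)
    also have "\<dots> = i.ev (\<Prod>w | rpoly f w = 0. [:- w, 1:]) (\<sigma> z)"
      by (simp add: minpoly_of_decompose[OF f] flip: ev_eq)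
    finally obtain w where w: "rpoly f w = 0" "\<sigma> z = \<iota> w"
      using i.ev_prod_linear_eq_0[OF y finite_rpoly_roots[OF minpoly_ofD(2)[OF f]] roots] by auto
    then obtain \<tau> where \<tau>: "\<tau> \<in> embeddings (adj z) CC" "\<tau> z = w"
      using bij_betw_imp_surj_on[OF embeddings_CC_bij[OF f]] by (metis (mono_tags, lifting) imageE mem_Collect_eq)
    have "\<sigma> = restrict (\<iota> \<circ> \<tau>) (adj z)"
      by (rule embedding_eqI[OF L \<sigma> emb[OF \<tau>(1)]]) (simp add: adj_self w \<tau>)
    thus "\<exists>\<tau>\<in>embeddings (adj z) CC. \<sigma> = restrict (\<iota> \<circ> \<tau>) (adj z)"
      using \<tau>(1) by blast
  qed (use emb in blast)
qed

section \<open>The p-adic absolute values of a number field\<close>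

text \<open>The absolute value of C_p pulled back along an embedding of S. From here on C_p itself
  can be forgotten.\<close>

locale padic_abs_on =
  fixes p :: nat and S :: "complex set" and w :: "complex \<Rightarrow> real"
  assumes nonneg: "x \<in> S \<Longrightarrow> 0 \<le> w x"
    and eq_0_iff: "x \<in> S \<Longrightarrow> w x = 0 \<longleftrightarrow> x = 0"
    and mult: "x \<in> S \<Longrightarrow> y \<in> S \<Longrightarrow> w (x * y) = w x * w y"
    and add: "x \<in> S \<Longrightarrow> y \<in> S \<Longrightarrow> w (x + y) \<le> max (w x) (w y)"
    and of_rat: "w (of_rat q) = padic_abs p q"

section \<open>Rational polynomials have roots in C_p\<close>

context padic_complex
begin

abbreviation int_embed :: "int \<Rightarrow> 'a" where
  "int_embed n \<equiv> [n] \<cdot> \<one>"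

lemma int_embed_closed [simp]: "int_embed n \<in> carrier C"
  by simp

lemma int_embed_add: "int_embed (m + n) = int_embed m \<oplus> int_embed n"
  by (simp add: add.int_pow_mult)

lemma int_embed_mult: "int_embed (m * n) = int_embed m \<otimes> int_embed n"
  by (simp add: add_pow_ldistr_int add.int_pow_pow mult.commute)

context
  assumes p: "p > 0"
begin

text \<open>C_p has characteristic 0 because its absolute value extends the p-adic one, which does
  not vanish at nonzero integers.\<close>

lemma int_embed_nonzero:
  assumes "n \<noteq> 0"
  shows "int_embed n \<noteq> \<zero>"
proof -
  have "rat_embed (of_int n) = int_embed n"
    unfolding rat_embed_def by simp
  moreover have "padic_abs p (of_int n) \<noteq> 0"
    using assms p by (simp add: padic_abs_def power_int_eq_0_iff)
  ultimately show ?thesis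
    using av_rat[of "of_int n"] av_eq_0_iff[of "int_embed n"] by auto
qed

lemma int_embed_cancel:
  "n \<noteq> 0 \<Longrightarrow> x \<in> carrier C \<Longrightarrow> y \<in> carrier C \<Longrightarrow> x \<otimes> int_embed n = y \<otimes> int_embed n \<longleftrightarrow> x = y"
  using int_embed_nonzero by (intro m_rcancel) auto

lemma rat_embed_closed [simp]: "rat_embed q \<in> carrier C"
proof -
  obtain a b where ab: "quotient_of q = (a, b)"
    by fastforce
  hence "b \<noteq> 0"
    using quotient_of_denom_pos by force
  thus ?thesis
    using int_embed_nonzero by (auto simp: rat_embed_def ab field_Units)
qed

text \<open>\<open>rat_embed\<close> is defined by the reduced fraction, and sums or products of
  reduced fractions need not be reduced. This form holds for every way of writing q with a
  denominator.\<close>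

lemma rat_embed_mult_int:
  assumes "q * of_int n = of_int m"
  shows "rat_embed q \<otimes> int_embed n = int_embed m"
proof -
  obtain a b where ab: "quotient_of q = (a, b)"
    by fastforce
  hence b: "b \<noteq> 0" and q: "q = of_int a / of_int b"
    using quotient_of_denom_pos quotient_of_div by (force, blast)
  have "(of_int (a * n) :: rat) = of_int (m * b)"
    using assms b by (simp add: q field_simps)
  hence eq: "a * n = m * b"
    by (simp only: of_int_eq_iff)
  have bU: "int_embed b \<in> Units C"
    using int_embed_nonzero[OF b] by (simp add: field_Units)
  have "rat_embed q \<otimes> int_embed n = inv (int_embed b) \<otimes> int_embed (a * n)"
    using bU by (simp add: rat_embed_def ab int_embed_mult m_ac)
  also have "\<dots> = inv (int_embed b) \<otimes> (int_embed b \<otimes> int_embed m)"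
    by (simp only: eq int_embed_mult m_comm[of "int_embed m" "int_embed b"] int_embed_closed)
  also have "\<dots> = (inv (int_embed b) \<otimes> int_embed b) \<otimes> int_embed m"
    using bU by (subst m_assoc) auto
  finally show ?thesis
    using bU by simp
qed

lemma hom_on_rat_embed: "hom_on C UNIV rat_embed"
proof (intro hom_on.intro hom_on_axioms.intro)
  fix x y :: rat
  obtain a b where ab: "quotient_of x = (a, b)" by fastforce
  obtain c d where cd: "quotient_of y = (c, d)" by fastforce
  have nz: "b \<noteq> 0" "d \<noteq> 0"
    using ab cd quotient_of_denom_pos by force+
  have x: "x * of_int b = of_int a" and y: "y * of_int d = of_int c"
    using nz quotient_of_div[OF ab] quotient_of_div[OF cd] by auto
  have bd: "b * d \<noteq> 0"
    using nz by simp
  note x' = rat_embed_mult_int[OF x] and y' = rat_embed_mult_int[OF y]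
  show "rat_embed (x + y) = rat_embed x \<oplus> rat_embed y"
  proof (subst int_embed_cancel[OF bd, symmetric])
    have "(x + y) * of_int (b * d) = of_int (a * d + c * b)"
      by (simp add: algebra_simps flip: x y)
    from rat_embed_mult_int[OF this]
    have "rat_embed (x + y) \<otimes> int_embed (b * d) = int_embed a \<otimes> int_embed d \<oplus> int_embed c \<otimes> int_embed b"
      by (simp only: int_embed_add int_embed_mult)
    also have "\<dots> = (rat_embed x \<oplus> rat_embed y) \<otimes> int_embed (b * d)"
      by (simp add: int_embed_mult l_distr r_distr m_ac flip: x' y')
    finally show "rat_embed (x + y) \<otimes> int_embed (b * d) = (rat_embed x \<oplus> rat_embed y) \<otimes> int_embed (b * d)" .
  qed auto
  show "rat_embed (x * y) = rat_embed x \<otimes> rat_embed y"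
  proof (subst int_embed_cancel[OF bd, symmetric])
    have "(x * y) * of_int (b * d) = of_int (a * c)"
      by (simp add: algebra_simps flip: x y)
    from rat_embed_mult_int[OF this]
    have "rat_embed (x * y) \<otimes> int_embed (b * d) = int_embed a \<otimes> int_embed c"
      by (simp only: int_embed_mult)
    also have "\<dots> = (rat_embed x \<otimes> rat_embed y) \<otimes> int_embed (b * d)"
      by (simp add: int_embed_mult m_ac flip: x' y')
    finally show "rat_embed (x * y) \<otimes> int_embed (b * d) = (rat_embed x \<otimes> rat_embed y) \<otimes> int_embed (b * d)" .
  qed auto
next
  show "rat_embed 1 = \<one>"
    by (simp add: rat_embed_def)
qed (auto intro: field_axioms)

lemma rat_embed_in_Qp: "rat_embed q \<in> Qp"
proof -
  interpret M: Metric_space "carrier C" vdist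
    by (rule Metric_space_vdist)
  have "range rat_embed \<subseteq> M.mtopology closure_of range rat_embed"
    by (rule closure_of_subset) auto
  thus ?thesis
    unfolding Qp_def by blast
qed

text \<open>The coefficients lie in Q_p, over which every polynomial splits in the algebraic closure
  \<open>Qp_bar\<close>; positive degree then yields a root.\<close>

lemma rat_poly_has_root:
  assumes "Polynomial.degree f > 0"
  obtains r where "r \<in> carrier C" "hom_on.ev C rat_embed f r = \<zero>"
proof -
  interpret h: hom_on C UNIV rat_embed
    by (rule hom_on_rat_embed)
  let ?B = "C\<lparr>carrier := Qp_bar\<rparr>"
  interpret B: algebraic_closure ?B Qp
    by (rule algebraic_closure_Qp)
  have QpB: "Qp \<subseteq> Qp_bar"
    using B.subset by simp
  define P where "P g = map rat_embed (rev (coeffs g))" for g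
  have P_carrier: "set (P g) \<subseteq> Qp" for g
    using rat_embed_in_Qp by (auto simp: P_def)
  have nz: "rat_embed q \<noteq> \<zero>" if "q \<noteq> 0" for q
    using h.mult[of q "inverse q"] that by (auto simp: h.one)
  have "P f \<in> carrier (Qp[X]\<^bsub>?B\<^esub>)"
    using P_carrier nz assms unfolding univ_poly_def polynomial_def
    by (auto simp: P_def hd_map hd_rev last_coeffs_eq_coeff_degree)
  hence split: "B.splitted (P f)"
    by (rule B.roots_over_subfield)
  have P_carrier': "P f \<in> carrier (poly_ring ?B)"
    using P_carrier QpB nz assms unfolding univ_poly_def polynomial_def
    by (auto simp: P_def hd_map hd_rev last_coeffs_eq_coeff_degree)
  have "length (P f) - 1 > 0"
    using assms by (simp add: P_def degree_eq_length_coeffs)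
  \<comment> \<open>\<open>splitted\<close> means that the multiset of roots has as many elements as
    the degree.\<close>
  hence "B.roots (P f) \<noteq> {#}"
    using split unfolding B.splitted_def by auto
  then obtain r where "r \<in># B.roots (P f)"
    by blast
  hence r: "r \<in> Qp_bar" "B.eval (P f) r = \<zero>"
    using B.roots_mem_iff_is_root[OF P_carrier'] by (auto simp: B.is_root_def)
  have rC: "r \<in> carrier C"
    using r(1) by (simp add: Qp_bar_def)
  have "B.eval (P g) r = h.ev g r" for g
  proof (induction g)
    case 0
    thus ?case by (simp add: P_def)
  next
    case (pCons a g)
    have "P (pCons a g) = P g @ [rat_embed a]"
      using pCons.hyps by (auto simp: P_def cCons_def)
    moreover have "B.eval (P g @ [rat_embed a]) r = B.eval (P g) r \<otimes> r \<oplus> rat_embed a"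
      using B.eval_append_aux[of "P g" "rat_embed a" r] P_carrier QpB rat_embed_in_Qp r(1) by auto
    ultimately show ?case
      using pCons.IH rC by (simp add: a_comm m_comm h.coeffs_in_def)
  qed
  with r(2) rC show ?thesis
    using that by metis
qed

end

end

text \<open>A root in C_p of the minimal polynomial of t gives \<iota>, and w is \<open>av\<close>
  composed with \<iota>. The two sums are related by the bijection
  \<open>embeddings_factor\<close>.\<close>

lemma padic_places:
  assumes C: "padic_complex C av p" and p: "p > 0"
    and f: "minpoly_of f z" and t: "Polynomial.algebraic t" and roots: "{w. rpoly f w = 0} \<subseteq> adj t"
  obtains w where "padic_abs_on p (adj t) w"
    "\<And>a b. a \<in> adj z \<Longrightarrow> b \<in> adj z \<Longrightarrow>
      (\<Sum>\<sigma>\<in>embeddings (adj z) C. ln (max (av (\<sigma> a)) (av (\<sigma> b)))) =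
      (\<Sum>\<tau>\<in>embeddings (adj z) CC. ln (max (w (\<tau> a)) (w (\<tau> b))))"
proof -
  interpret C: padic_complex C av p
    by (rule C)
  have L: "field C"
    by (rule C.field_axioms)
  obtain F where F: "minpoly_of F t"
    using minpoly_of_exists[OF t] by blast
  obtain r where r: "r \<in> carrier C" "hom_on.ev C C.rat_embed F r = \<zero>\<^bsub>C\<^esub>"
    using C.rat_poly_has_root[OF p minpoly_of_degree_pos[OF F]] .
  obtain \<iota> where \<iota>: "\<iota> \<in> embeddings (adj t) C"
    using embedding_exists[OF F C.hom_on_rat_embed[OF p] r] by blast
  interpret i: hom_on C "adj t" \<iota>
    by (rule hom_on_embedding[OF L \<iota>])
  have \<iota>_rat: "\<iota> (of_rat q) = C.rat_embed q" for q
    using hom_on_rat_unique[OF hom_on_rat_restrict[OF i.hom_on_axioms] C.hom_on_rat_embed[OF p]]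
    by (rule fun_cong)
  have \<iota>_0: "\<iota> x = \<zero>\<^bsub>C\<^esub> \<longleftrightarrow> x = 0" if x: "x \<in> adj t" for x
  proof
    assume 0: "\<iota> x = \<zero>\<^bsub>C\<^esub>"
    show "x = 0"
    proof (rule ccontr)
      assume "x \<noteq> 0"
      hence "\<iota> x \<otimes>\<^bsub>C\<^esub> \<iota> (inverse x) = \<one>\<^bsub>C\<^esub>"
        using i.mult[OF x adj_inverse[OF t x]] i.one by simp
      thus False
        using 0 adj_inverse[OF t x] by simp
    qed
  qed (simp add: i.zero)
  note bij = embeddings_factor(1)[OF t f L \<iota> roots]
  note mem = embeddings_factor(2)[OF t f L \<iota> roots]
  show ?thesis
  proof (rule that[of "\<lambda>x. av (\<iota> x)"])
    show "padic_abs_on p (adj t) (\<lambda>x. av (\<iota> x))"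
      by unfold_locales
         (auto simp: C.av_nonneg C.av_eq_0_iff \<iota>_0 i.mult i.add C.av_mult C.av_add \<iota>_rat C.av_rat)
    fix a b assume "a \<in> adj z" "b \<in> adj z"
    thus "(\<Sum>\<sigma>\<in>embeddings (adj z) C. ln (max (av (\<sigma> a)) (av (\<sigma> b)))) =
      (\<Sum>\<tau>\<in>embeddings (adj z) CC. ln (max (av (\<iota> (\<tau> a))) (av (\<iota> (\<tau> b)))))"
      by (subst sum.reindex_bij_betw[OF bij, symmetric]) simp
  qed
qed

section \<open>Conjugates and characteristic polynomials\<close>

text \<open>Write x = h(t) with h of smaller degree than the minimal polynomial F of t. Being fixed
  means that h - x vanishes at every conjugate of t. These are as many as the degree of F, so h is
  the constant x, and its coefficient is rational.\<close>

lemma rational_if_fixed: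
  assumes t: "Polynomial.algebraic t" and x: "x \<in> adj t"
    and fixed: "\<And>s. s \<in> embeddings (adj t) CC \<Longrightarrow> s x = x"
  shows "x \<in> \<rat>"
proof -
  obtain F where F: "minpoly_of F t"
    using minpoly_of_exists[OF t] by blast
  obtain g where g: "x = rpoly g t"
    using x by (rule adjE)
  define h where "h = g mod F"
  have "g = F * (g div F) + h"
    by (simp add: h_def)
  hence xh: "x = rpoly h t"
    using minpoly_ofD(3)[OF F] g by (metis add_0 mult_zero_left rpoly_add rpoly_mult)
  have deg: "Polynomial.degree h < Polynomial.degree F"
    using degree_mod_less[OF minpoly_ofD(2)[OF F], of g] minpoly_of_degree_pos[OF F] by (auto simp: h_def)
  define H where "H = map_poly of_rat h - [:x:]"
  have "{w. rpoly F w = 0} \<subseteq> {w. poly H w = 0}"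
  proof safe
    fix w assume "rpoly F w = 0"
    hence "w \<in> (\<lambda>s. s t) ` embeddings (adj t) CC"
      using bij_betw_imp_surj_on[OF embeddings_CC_bij[OF F]] by simp
    then obtain s where s: "s \<in> embeddings (adj t) CC" "s t = w"
      by blast
    have "x = rpoly h w"
      using fixed[OF s(1)] embedding_CC_rpoly[OF s(1) adj_self, of h] s(2) xh by simp
    thus "poly H w = 0"
      by (simp add: H_def rpoly_def)
  qed
  moreover have "card {w. poly H w = 0} \<le> Polynomial.degree H" "finite {w. poly H w = 0}" if "H \<noteq> 0"
    using that by (simp_all add: card_poly_roots_bound poly_roots_finite)
  moreover have "Polynomial.degree H < Polynomial.degree F"
    unfolding H_def using deg by (intro degree_diff_less) auto
  ultimately have "H = 0"
    using card_rpoly_roots[OF F] card_mono by (metis leD le_trans)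
  hence "Polynomial.coeff H 0 = 0"
    by simp
  hence "x = of_rat (Polynomial.coeff h 0)"
    by (simp add: H_def coeff_map_poly)
  thus ?thesis
    by simp
qed

text \<open>Each coefficient is a polynomial expression in the c a, so s may be moved inside. The
  induction multiplies by one linear factor at a time.\<close>

lemma coeff_prod_linear_hom:
  assumes "hom_on CC (adj t) s" "finite A" "\<And>a. a \<in> A \<Longrightarrow> c a \<in> adj t"
  shows "Polynomial.coeff (\<Prod>a\<in>A. [:- c a, 1:]) i \<in> adj t \<and>
    s (Polynomial.coeff (\<Prod>a\<in>A. [:- c a, 1:]) i) = Polynomial.coeff (\<Prod>a\<in>A. [:- s (c a), 1:]) i"
proof -
  interpret s: hom_on CC "adj t" s by fact
  show ?thesis
    using assms(2,3)
  proof (induction arbitrary: i rule: finite_induct)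
    case empty
    thus ?case
      using s.S_0 s.S_1 s.zero s.one by (auto simp: one_pCons coeff_pCons split: nat.splits)
  next
    case (insert a A)
    define P where "P = (\<Prod>a\<in>A. [:- c a, 1:])"
    define Q where "Q = (\<Prod>a\<in>A. [:- s (c a), 1:])"
    have IH: "Polynomial.coeff P j \<in> adj t" "s (Polynomial.coeff P j) = Polynomial.coeff Q j" for j
      using insert.IH insert.prems by (auto simp: P_def Q_def)
    have ca: "c a \<in> adj t"
      using insert.prems by simp
    have mult_linear: "Polynomial.coeff ([:- b, 1:] * R) i = - b * Polynomial.coeff R i +
        (case i of 0 \<Rightarrow> 0 | Suc j \<Rightarrow> Polynomial.coeff R j)" for b :: complex and R
      by (auto simp: coeff_pCons split: nat.splits)
    let ?r = "\<lambda>R. case i of 0 \<Rightarrow> 0 | Suc j \<Rightarrow> Polynomial.coeff R j"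
    have r: "?r P \<in> adj t" "s (?r P) = ?r Q"
      using IH s.S_0 s.zero by (auto split: nat.splits)
    have l: "- c a * Polynomial.coeff P i \<in> adj t"
      by (intro adj_mult adj_uminus ca IH)
    have "s (- c a * Polynomial.coeff P i + ?r P) = - s (c a) * Polynomial.coeff Q i + ?r Q"
      using s.add[OF l r(1)] s.mult[OF adj_uminus[OF ca] IH(1)] s.uminus[OF ca] r(2) IH(2)
      by simp
    moreover have "- c a * Polynomial.coeff P i + ?r P \<in> adj t"
      using l r(1) by (rule adj_add)
    moreover have "(\<Prod>a\<in>insert a A. [:- c a, 1:]) = [:- c a, 1:] * P"
      "(\<Prod>a\<in>insert a A. [:- s (c a), 1:]) = [:- s (c a), 1:] * Q"
      by (simp_all only: prod.insert[OF insert.hyps] P_def Q_def)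
    ultimately show ?case
      by (simp only: mult_linear)
  qed
qed

text \<open>\<open>adj t\<close> plays the part of a normal closure of \<open>adj z\<close>:
  containing all conjugates of z, it contains the image of \<open>adj z\<close> under every complex
  embedding.\<close>

locale number_field_in_normal =
  fixes z t :: complex and f :: "rat poly"
  assumes f: "minpoly_of f z" and t: "Polynomial.algebraic t"
    and roots: "{w. rpoly f w = 0} \<subseteq> adj t"
begin

abbreviation T :: "(complex \<Rightarrow> complex) set" where
  "T \<equiv> embeddings (adj z) CC"

lemma alg_z: "Polynomial.algebraic z"
  using f algebraic_iff_rpoly minpoly_ofD(2,3) by blast

lemmas finite_T [simp] = card_embeddings_CC(1)[OF alg_z]
lemmas card_T = card_embeddings_CC(2)[OF alg_z]
lemmas card_T_pos = card_embeddings_CC(3)[OF alg_z, folded card_T]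

lemma T_mem: "\<tau> \<in> T \<Longrightarrow> u \<in> adj z \<Longrightarrow> \<tau> u \<in> adj t"
proof -
  have "restrict id (adj t) \<in> embeddings (adj t) CC"
    using adj_of_rat[of 1 t] by (intro embeddingsI) (auto intro: adj_add adj_mult)
  thus "\<tau> \<in> T \<Longrightarrow> u \<in> adj z \<Longrightarrow> \<tau> u \<in> adj t"
    using embeddings_factor(2)[OF t f field_from_type_algebra _ roots] by blast
qed

lemma T_mult: "\<tau> \<in> T \<Longrightarrow> u \<in> adj z \<Longrightarrow> v \<in> adj z \<Longrightarrow> \<tau> (u * v) = \<tau> u * \<tau> v"
  using hom_on.mult[OF hom_on_CC] by simp

lemma T_1: "\<tau> \<in> T \<Longrightarrow> \<tau> 1 = 1"
  using hom_on.one[OF hom_on_CC] by simp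

lemma T_0: "\<tau> \<in> T \<Longrightarrow> \<tau> 0 = 0"
  using hom_on.zero[OF hom_on_CC] by simp

lemma T_nonzero: "\<tau> \<in> T \<Longrightarrow> u \<in> adj z \<Longrightarrow> u \<noteq> 0 \<Longrightarrow> \<tau> u \<noteq> 0"
  using T_mult[of \<tau> u "inverse u"] T_1[of \<tau>] adj_inverse[OF alg_z, of u] by auto

lemma adj_power: "u \<in> adj z \<Longrightarrow> u ^ n \<in> adj z"
  using adj_of_rat[of 1 z] by (induction n) (auto intro: adj_mult)

lemma T_power: "\<tau> \<in> T \<Longrightarrow> u \<in> adj z \<Longrightarrow> \<tau> (u ^ n) = \<tau> u ^ n"
  by (induction n) (auto simp: T_1 T_mult adj_power)

text \<open>The characteristic polynomial of multiplication by u on \<open>adj z\<close>, a power of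
  the minimal polynomial of u. Unlike the latter it has the same degree for all u.\<close>

definition charpoly :: "complex \<Rightarrow> complex poly" where
  "charpoly u = (\<Prod>\<tau>\<in>T. [:- \<tau> u, 1:])"

text \<open>An embedding s of \<open>adj t\<close> permutes the factors, because composing with s
  permutes T; so every coefficient is fixed by every s.\<close>

lemma charpoly_coeff:
  assumes u: "u \<in> adj z"
  shows "Polynomial.coeff (charpoly u) i \<in> \<rat>"
proof (rule rational_if_fixed[OF t])
  show "Polynomial.coeff (charpoly u) i \<in> adj t"
  proof -
    have "restrict id (adj t) \<in> embeddings (adj t) CC"
      using adj_of_rat[of 1 t] by (intro embeddingsI) (auto intro: adj_add adj_mult)
    from coeff_prod_linear_hom[OF hom_on_CC[OF this] finite_T, of "\<lambda>\<tau>. \<tau> u"] u T_mem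
    show ?thesis by (simp add: charpoly_def)
  qed
  fix s assume s: "s \<in> embeddings (adj t) CC"
  have "s (Polynomial.coeff (charpoly u) i) = Polynomial.coeff (\<Prod>\<tau>\<in>T. [:- s (\<tau> u), 1:]) i"
    unfolding charpoly_def using coeff_prod_linear_hom[OF hom_on_CC[OF s] finite_T, of "\<lambda>\<tau>. \<tau> u"] u T_mem by blast
  also have "(\<Prod>\<tau>\<in>T. [:- s (\<tau> u), 1:]) = (\<Prod>\<tau>\<in>T. [:- restrict (s \<circ> \<tau>) (adj z) u, 1:])"
    using u by simp
  also have "\<dots> = charpoly u"
    unfolding charpoly_def
    by (rule prod.reindex_bij_betw[OF embeddings_factor(1)[OF t f field_from_type_algebra s roots]])
  finally show "s (Polynomial.coeff (charpoly u) i) = Polynomial.coeff (charpoly u) i" .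
qed

lemma lead_coeff_charpoly: "Polynomial.lead_coeff (charpoly u) = 1"
  by (simp add: charpoly_def lead_coeff_prod)

lemma charpoly_nonzero: "charpoly u \<noteq> 0"
  using lead_coeff_charpoly[of u] by auto

lemma degree_charpoly: "Polynomial.degree (charpoly u) = card T"
  unfolding charpoly_def by (subst degree_prod_eq_sum_degree) auto

lemma poly_charpoly_conjugate: "\<tau> \<in> T \<Longrightarrow> poly (charpoly u) (\<tau> u) = 0"
  by (auto simp: charpoly_def poly_prod prod_zero_iff)

text \<open>The norm of u up to sign. The signs are kept because this is literally the constant
  coefficient of \<open>charpoly\<close>, and absolute values do not see them.\<close>

lemma norm_rational:
  assumes "u \<in> adj z"
  obtains q where "(\<Prod>\<tau>\<in>T. - \<tau> u) = of_rat q"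
proof -
  have "(\<Prod>\<tau>\<in>T. - \<tau> u) = Polynomial.coeff (charpoly u) 0"
    by (simp add: charpoly_def poly_prod flip: poly_0_coeff_0)
  thus ?thesis
    using charpoly_coeff[OF assms, of 0] that by (auto elim: Rats_cases)
qed

end

section \<open>Ultrametric estimates for integral elements\<close>

context padic_abs_on
begin

lemma one: "w 1 = 1"
  using of_rat[of 1] by (simp add: padic_abs_def)

lemma minus_one: "w (- 1) = 1"
  using of_rat[of "- 1"] by (simp add: padic_abs_def of_rat_minus quotient_of_int rat_uminus_code)

lemma zero: "w 0 = 0"
  using of_rat[of 0] by (simp add: padic_abs_def)

end

locale padic_abs_on_field = padic_abs_on p "adj t" w for p t w
begin

lemma uminus: "x \<in> adj t \<Longrightarrow> w (- x) = w x"
  using mult[of "- 1" x] adj_of_rat[of "- 1" t] minus_one by (simp add: of_rat_minus)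

text \<open>The ultrametric inequality for y = (x + y) + (- x) gives the missing bound, as x is too
  small to attain the maximum.\<close>

lemma add_eq:
  assumes "x \<in> adj t" "y \<in> adj t" "w x < w y"
  shows "w (x + y) = w y"
  using add[OF assms(1,2)] add[OF adj_add[OF assms(1,2)] adj_uminus[OF assms(1)]] uminus[OF assms(1)] assms(3)
  by auto

lemma power: "x \<in> adj t \<Longrightarrow> w (x ^ n) = w x ^ n"
proof (induction n)
  case (Suc n)
  have "x ^ n \<in> adj t"
    using adj_of_rat[of 1 t] Suc.prems by (induction n) (auto intro: adj_mult)
  thus ?case
    using Suc by (simp add: mult)
qed (simp add: one)

lemma prod: "(\<And>a. a \<in> A \<Longrightarrow> c a \<in> adj t) \<Longrightarrow> w (\<Prod>a\<in>A. c a) = (\<Prod>a\<in>A. w (c a)) \<and> (\<Prod>a\<in>A. c a) \<in> adj t"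
  using adj_of_rat[of 1 t] by (induction A rule: infinite_finite_induct) (auto simp: one mult intro: adj_mult)

lemma poly_adj: "x \<in> adj t \<Longrightarrow> P \<in> polys_over (adj t) \<Longrightarrow> poly P x \<in> adj t"
proof (induction P)
  case (pCons a P)
  thus ?case
    by (auto simp: polys_over_pCons_iff intro!: adj_add adj_mult)
qed (use adj_of_rat[of 0 t] in simp)

text \<open>If x had value above 1, the leading term would dominate all others, and P(x) would have
  the value of x to the power deg P instead of 0. The induction follows Horner's scheme.\<close>

lemma integral_le_1:
  assumes x: "x \<in> adj t" and P: "P \<in> polys_over (adj t)" "Polynomial.lead_coeff P = 1" "poly P x = 0"
    and le: "\<And>i. w (Polynomial.coeff P i) \<le> 1"
  shows "w x \<le> 1"
proof (rule ccontr)
  assume gt: "\<not> w x \<le> 1"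
  have "w (poly P x) = w x ^ Polynomial.degree P"
    using P(1,2) le
  proof (induction P)
    case (pCons a P)
    show ?case
    proof (cases "P = 0")
      case True
      thus ?thesis using pCons.prems by (simp add: one)
    next
      case False
      have a: "a \<in> adj t" "w a \<le> 1" and PS: "P \<in> polys_over (adj t)"
        using pCons.prems(1) pCons.prems(3)[of 0] by (auto simp: polys_over_pCons_iff)
      have "w (Polynomial.coeff P i) \<le> 1" for i
        using pCons.prems(3)[of "Suc i"] by simp
      hence IH: "w (poly P x) = w x ^ Polynomial.degree P"
        using pCons.IH PS pCons.prems(2) False by simp
      hence y: "w (x * poly P x) = w x ^ Suc (Polynomial.degree P)"
        using x poly_adj PS by (simp add: mult)
      \<comment> \<open>The constant coefficient a has value at most 1, so it is strictly dominated
        by x P(x).\<close>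
      have "1 < w x ^ Suc (Polynomial.degree P)"
        using gt by (intro one_less_power) auto
      hence "w (a + x * poly P x) = w x ^ Suc (Polynomial.degree P)"
        using add_eq[of a "x * poly P x"] a x poly_adj PS y adj_mult by auto
      thus ?thesis
        using False by simp
    qed
  qed simp
  thus False
    using gt P(3) zero by simp
qed

lemma coeff_prod_linear_le_1:
  assumes "finite A" "\<And>a. a \<in> A \<Longrightarrow> c a \<in> adj t \<and> w (c a) \<le> 1"
  shows "Polynomial.coeff (\<Prod>a\<in>A. [:- c a, 1:]) i \<in> adj t \<and> w (Polynomial.coeff (\<Prod>a\<in>A. [:- c a, 1:]) i) \<le> 1"
  using assms
proof (induction arbitrary: i rule: finite_induct)
  case empty
  show ?case
    using adj_of_rat[of 0 t] adj_of_rat[of 1 t] by (auto simp: one_pCons coeff_pCons one zero split: nat.splits)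
next
  case (insert a A)
  define P where "P = (\<Prod>a\<in>A. [:- c a, 1:])"
  have IH: "Polynomial.coeff P j \<in> adj t" "w (Polynomial.coeff P j) \<le> 1" for j
    using insert.IH insert.prems by (auto simp: P_def)
  have ca: "c a \<in> adj t" "w (c a) \<le> 1"
    using insert.prems by auto
  let ?r = "case i of 0 \<Rightarrow> 0 | Suc j \<Rightarrow> Polynomial.coeff P j"
  have r: "?r \<in> adj t" "w ?r \<le> 1"
    using IH adj_of_rat[of 0 t] by (auto simp: zero split: nat.splits)
  have l: "- c a * Polynomial.coeff P i \<in> adj t"
    by (intro adj_mult adj_uminus ca IH)
  have "w (- c a * Polynomial.coeff P i) \<le> 1"
    using mult_mono[OF ca(2) IH(2)[of i]] ca IH nonneg
    by (subst mult) (auto simp: uminus adj_uminus)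
  hence "w (- c a * Polynomial.coeff P i + ?r) \<le> 1"
    using add[OF l r(1)] r(2) by linarith
  moreover have "- c a * Polynomial.coeff P i + ?r \<in> adj t"
    using l r(1) by (rule adj_add)
  moreover have "Polynomial.coeff ([:- c a, 1:] * P) i = - c a * Polynomial.coeff P i + ?r"
    by (auto simp: coeff_pCons split: nat.splits)
  moreover have "(\<Prod>a\<in>insert a A. [:- c a, 1:]) = [:- c a, 1:] * P"
    by (simp only: prod.insert[OF insert.hyps] P_def)
  ultimately show ?case
    by (simp only:)
qed

end

section \<open>Product formula and Kronecker's theorem\<close>

lemma padic_abs_ln:
  assumes "q \<noteq> 0" "p > 0" "quotient_of q = (a, b)"
  shows "ln (padic_abs p q) = (real (multiplicity (int p) b) - real (multiplicity (int p) a)) * ln (real p)"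
proof -
  have "padic_abs p q = real p powr (real_of_int (int (multiplicity (int p) b) - int (multiplicity (int p) a)))"
    using assms by (simp add: padic_abs_def flip: powr_real_of_int')
  thus ?thesis
    using assms(2) by (simp add: ln_powr)
qed

lemma padic_abs_pos: "q \<noteq> 0 \<Longrightarrow> p > 0 \<Longrightarrow> padic_abs p q > 0"
  by (auto simp: padic_abs_def split: prod.splits)

lemma ln_abs_int:
  assumes "a \<noteq> 0" "finite S" "\<And>p. p \<in> S \<Longrightarrow> Factorial_Ring.prime p"
    and dvd: "\<And>p. Factorial_Ring.prime p \<Longrightarrow> int p dvd a \<Longrightarrow> p \<in> S"
  shows "ln (real_of_int \<bar>a\<bar>) = (\<Sum>p\<in>S. real (multiplicity (int p) a) * ln (real p))"
proof -
  have sub: "prime_factors a \<subseteq> int ` S"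
  proof
    fix q assume q: "q \<in> prime_factors a"
    hence "Factorial_Ring.prime q" "q dvd a"
      by auto
    moreover from this have "q = int (nat q)"
      by (simp add: prime_ge_0_int)
    ultimately have "nat q \<in> S"
      using dvd[of "nat q"] by (metis prime_nat_int_transfer)
    thus "q \<in> int ` S"
      using \<open>q = int (nat q)\<close> by blast
  qed
  have pos: "q > 0" if "q \<in> prime_factors a" for q
    using that by (auto intro: prime_gt_0_int)
  have "\<bar>a\<bar> = (\<Prod>q\<in>prime_factors a. q ^ multiplicity q a)"
    using prod_prime_factors[OF assms(1)] by simp
  hence "real_of_int \<bar>a\<bar> = (\<Prod>q\<in>prime_factors a. real_of_int q ^ multiplicity q a)"
    by simp
  hence "ln (real_of_int \<bar>a\<bar>) = (\<Sum>q\<in>prime_factors a. ln (real_of_int q ^ multiplicity q a))"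
    using pos by (simp add: ln_prod)
  also have "\<dots> = (\<Sum>q\<in>prime_factors a. real (multiplicity q a) * ln (real_of_int q))"
    using pos by (intro sum.cong) (auto simp: ln_realpow)
  also have "\<dots> = (\<Sum>q\<in>int ` S. real (multiplicity q a) * ln (real_of_int q))"
  proof (rule sum.mono_neutral_left)
    show "\<forall>q\<in>int ` S - prime_factors a. real (multiplicity q a) * ln (real_of_int q) = 0"
      using assms(1,3) by (auto simp: prime_factors_dvd not_dvd_imp_multiplicity_0)
  qed (use sub assms in auto)
  also have "\<dots> = (\<Sum>p\<in>S. real (multiplicity (int p) a) * ln (real p))"
    by (subst sum.reindex) auto
  finally show ?thesis .
qed

text \<open>For p outside S, value 1 says that p has the same multiplicity in numerator and
  denominator. These are coprime, so p divides neither, and S contains all primes in the two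
  factorizations.\<close>

lemma product_formula:
  assumes q: "q \<noteq> 0" and S: "finite S" "\<And>p. p \<in> S \<Longrightarrow> Factorial_Ring.prime p"
    and out: "\<And>p. Factorial_Ring.prime p \<Longrightarrow> p \<notin> S \<Longrightarrow> padic_abs p q = 1"
  shows "ln \<bar>real_of_rat q\<bar> + (\<Sum>p\<in>S. ln (padic_abs p q)) = 0"
proof -
  obtain a b where ab: "quotient_of q = (a, b)"
    by fastforce
  have b: "b > 0" and qab: "q = of_int a / of_int b" and cop: "coprime a b"
    using quotient_of_denom_pos[OF ab] quotient_of_div[OF ab] quotient_of_coprime[OF ab] .
  have a: "a \<noteq> 0"
    using q qab by auto
  have ndvd: "\<not> int p dvd a \<and> \<not> int p dvd b" if p: "Factorial_Ring.prime p" "p \<notin> S" for p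
  proof -
    have "p > 1"
      using p(1) prime_gt_1_nat by blast
    have "ln (padic_abs p q) = 0"
      using out[OF p] by simp
    hence eq: "multiplicity (int p) b = multiplicity (int p) a"
      using padic_abs_ln[OF q _ ab, of p] \<open>p > 1\<close> by simp
    have "\<not> is_unit (int p)"
      using \<open>p > 1\<close> by simp
    hence "\<not> int p dvd a \<or> \<not> int p dvd b"
      using cop coprime_common_divisor by blast
    hence "multiplicity (int p) a = 0 \<and> multiplicity (int p) b = 0"
      using eq not_dvd_imp_multiplicity_0 by metis
    thus ?thesis
      using a b \<open>\<not> is_unit (int p)\<close> by (auto simp: multiplicity_eq_zero_iff)
  qed
  have "\<bar>real_of_rat q\<bar> = real_of_int \<bar>a\<bar> / real_of_int \<bar>b\<bar>"
    using b by (simp add: qab of_rat_divide)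
  hence "ln \<bar>real_of_rat q\<bar> = ln (real_of_int \<bar>a\<bar>) - ln (real_of_int \<bar>b\<bar>)"
    using a b by (simp add: ln_div)
  also have "ln (real_of_int \<bar>a\<bar>) = (\<Sum>p\<in>S. real (multiplicity (int p) a) * ln (real p))"
    using a S ndvd by (intro ln_abs_int) auto
  also have "ln (real_of_int \<bar>b\<bar>) = (\<Sum>p\<in>S. real (multiplicity (int p) b) * ln (real p))"
    using b S ndvd by (intro ln_abs_int) auto
  finally have "ln \<bar>real_of_rat q\<bar> = (\<Sum>p\<in>S. - ln (padic_abs p q))"
    using S(2) prime_gt_0_nat
    by (simp add: padic_abs_ln[OF q _ ab] algebra_simps flip: sum_subtractf)
  thus ?thesis
    by (simp add: sum_negf)
qed

text \<open>Such primes divide the denominator of q.\<close>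

lemma finite_padic_abs_gt_1: "finite {p. Factorial_Ring.prime p \<and> padic_abs p q > 1}"
proof (cases "q = 0")
  case True
  thus ?thesis by (simp add: padic_abs_def)
next
  case False
  obtain a b where ab: "quotient_of q = (a, b)"
    by fastforce
  have b: "b > 0"
    using quotient_of_denom_pos[OF ab] .
  have "{p. Factorial_Ring.prime p \<and> padic_abs p q > 1} \<subseteq> nat ` {d. d dvd b}"
  proof safe
    fix p assume p: "Factorial_Ring.prime p" "padic_abs p q > 1"
    have "p > 1"
      using p(1) prime_gt_1_nat by blast
    hence "ln (padic_abs p q) > 0"
      using p(2) by simp
    hence "multiplicity (int p) b > 0"
      using padic_abs_ln[OF False _ ab, of p] \<open>p > 1\<close> by (auto simp: zero_less_mult_iff)
    hence "int p dvd b"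
      using not_dvd_imp_multiplicity_0 by force
    thus "p \<in> nat ` {d. d dvd b}"
      by (intro image_eqI[of _ _ "int p"]) auto
  qed
  moreover have "finite {d. d dvd b}"
    using b by simp
  ultimately show ?thesis
    using finite_subset by blast
qed

lemma Ints_if_padic_abs_le_1:
  assumes "\<And>p. Factorial_Ring.prime p \<Longrightarrow> padic_abs p q \<le> 1"
  shows "q \<in> \<int>"
proof (cases "q = 0")
  case False
  obtain a b where ab: "quotient_of q = (a, b)"
    by fastforce
  have b: "b > 0" and qab: "q = of_int a / of_int b" and cop: "coprime a b"
    using quotient_of_denom_pos[OF ab] quotient_of_div[OF ab] quotient_of_coprime[OF ab] .
  have "b = 1"
  proof (rule ccontr)
    assume "b \<noteq> 1"
    hence "\<exists>p. Factorial_Ring.prime p \<and> p dvd nat b"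
      using b by (intro prime_factor_nat) auto
    then obtain p where p: "Factorial_Ring.prime p" "int p dvd b"
      using b by (metis int_dvd_int_iff nat_0_le less_imp_le)
    have "p > 1"
      using p(1) prime_gt_1_nat by blast
    hence "\<not> is_unit (int p)"
      by simp
    hence "multiplicity (int p) a = 0"
      using cop p(2) coprime_common_divisor not_dvd_imp_multiplicity_0 by metis
    moreover have "multiplicity (int p) b > 0"
      using p(2) b \<open>\<not> is_unit (int p)\<close> by (simp add: multiplicity_gt_zero_iff)
    ultimately have "ln (padic_abs p q) > 0"
      using padic_abs_ln[OF False _ ab, of p] \<open>p > 1\<close> by simp
    moreover have "padic_abs p q > 0"
      using padic_abs_pos[OF False] \<open>p > 1\<close> by simp
    ultimately show False
      using assms[OF p(1)] by (simp add: ln_gt_zero_iff)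
  qed
  thus ?thesis
    by (simp add: qab)
qed auto

text \<open>A factor X - c with c in the unit disc at most doubles the largest coefficient.\<close>

lemma coeff_prod_linear_bound:
  fixes c :: "'a \<Rightarrow> complex"
  assumes "finite A" "\<And>a. a \<in> A \<Longrightarrow> cmod (c a) \<le> 1"
  shows "cmod (Polynomial.coeff (\<Prod>a\<in>A. [:- c a, 1:]) i) \<le> 2 ^ card A"
  using assms
proof (induction arbitrary: i rule: finite_induct)
  case empty
  show ?case
    by (auto simp: one_pCons coeff_pCons split: nat.splits)
next
  case (insert a A)
  define P where "P = (\<Prod>a\<in>A. [:- c a, 1:])"
  have IH: "cmod (Polynomial.coeff P j) \<le> 2 ^ card A" for j
    using insert.IH insert.prems by (auto simp: P_def)
  let ?r = "case i of 0 \<Rightarrow> 0 | Suc j \<Rightarrow> Polynomial.coeff P j"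
  have r: "cmod ?r \<le> 2 ^ card A"
    using IH by (auto split: nat.splits)
  have l: "cmod (c a * Polynomial.coeff P i) \<le> 1 * 2 ^ card A"
    unfolding norm_mult using insert.prems IH by (intro mult_mono) auto
  have eq: "Polynomial.coeff ([:- c a, 1:] * P) i = ?r - c a * Polynomial.coeff P i"
    by (auto simp: coeff_pCons split: nat.splits)
  have "cmod (Polynomial.coeff ([:- c a, 1:] * P) i) \<le> 2 ^ card A + 2 ^ card A"
    unfolding eq using r l norm_triangle_ineq4[of ?r "c a * Polynomial.coeff P i"] by linarith
  moreover have "(\<Prod>a\<in>insert a A. [:- c a, 1:]) = [:- c a, 1:] * P"
    by (simp only: prod.insert[OF insert.hyps] P_def)
  ultimately show ?case
    using insert.hyps by simp
qed

section \<open>Values of conjugates at all primes, the product formula for norms, and Kronecker's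
  theorem\<close>

locale number_field_places = number_field_in_normal z t f for z t f +
  fixes w :: "nat \<Rightarrow> complex \<Rightarrow> real"
  assumes w: "Factorial_Ring.prime p \<Longrightarrow> padic_abs_on p (adj t) (w p)"
begin

lemma wf: "Factorial_Ring.prime p \<Longrightarrow> padic_abs_on_field p t (w p)"
  using w by (simp add: padic_abs_on_field_def)

lemma w_pos:
  assumes "Factorial_Ring.prime p" "\<tau> \<in> T" "u \<in> adj z" "u \<noteq> 0"
  shows "w p (\<tau> u) > 0"
proof -
  interpret padic_abs_on_field p t "w p"
    by (rule wf) fact
  show ?thesis
    using nonneg eq_0_iff T_mem T_nonzero assms by (simp add: less_le)
qed

text \<open>By \<open>integral_le_1\<close> a conjugate of value above 1 forces a coefficient of
  \<open>charpoly u\<close> of value above 1. There are finitely many coefficients, all rational,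
  and each allows finitely many primes.\<close>

lemma finite_conjugates_gt_1:
  assumes u: "u \<in> adj z"
  shows "finite {p. Factorial_Ring.prime p \<and> (\<exists>\<tau>\<in>T. w p (\<tau> u) > 1)}"
proof -
  have "\<exists>q. \<forall>i. Polynomial.coeff (charpoly u) i = of_rat (q i)"
    using charpoly_coeff[OF u] by (intro choice) (auto elim: Rats_cases)
  then obtain q where q: "Polynomial.coeff (charpoly u) i = of_rat (q i)" for i
    by blast
  have "{p. Factorial_Ring.prime p \<and> (\<exists>\<tau>\<in>T. w p (\<tau> u) > 1)} \<subseteq>
      (\<Union>i\<le>Polynomial.degree (charpoly u). {p. Factorial_Ring.prime p \<and> padic_abs p (q i) > 1})"
  proof (rule subsetI, rule ccontr)
    fix p assume "p \<in> {p. Factorial_Ring.prime p \<and> (\<exists>\<tau>\<in>T. w p (\<tau> u) > 1)}"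
    then obtain \<tau> where p: "Factorial_Ring.prime p" and \<tau>: "\<tau> \<in> T" "w p (\<tau> u) > 1"
      by blast
    interpret padic_abs_on_field p t "w p"
      by (rule wf) fact
    assume notin: "p \<notin> (\<Union>i\<le>Polynomial.degree (charpoly u). {p. Factorial_Ring.prime p \<and> padic_abs p (q i) > 1})"
    have le: "padic_abs p (q i) \<le> 1" if "i \<le> Polynomial.degree (charpoly u)" for i
    proof (rule ccontr)
      assume "\<not> padic_abs p (q i) \<le> 1"
      hence "p \<in> {p. Factorial_Ring.prime p \<and> padic_abs p (q i) > 1}"
        using p by simp
      thus False
        using notin that by blast
    qed
    have "w p (Polynomial.coeff (charpoly u) i) \<le> 1" for i
    proof (cases "i \<le> Polynomial.degree (charpoly u)")
      case True
      thus ?thesis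
        using le by (simp add: q of_rat)
    next
      case False
      thus ?thesis
        using zero by (simp add: coeff_eq_0)
    qed
    moreover have "charpoly u \<in> polys_over (adj t)"
      by (auto simp: polys_over_def q adj_of_rat)
    ultimately have "w p (\<tau> u) \<le> 1"
      using integral_le_1[of "\<tau> u" "charpoly u"] T_mem[OF \<tau>(1) u] lead_coeff_charpoly
        poly_charpoly_conjugate[OF \<tau>(1)] by blast
    thus False
      using \<tau>(2) by simp
  qed
  thus ?thesis
    by (rule finite_subset) (intro finite_UN_I finite_atMost finite_padic_abs_gt_1)
qed

text \<open>A value below 1 for u is a value above 1 for its inverse.\<close>

lemma finite_conjugates_neq_1:
  assumes u: "u \<in> adj z" "u \<noteq> 0"
  shows "finite {p. Factorial_Ring.prime p \<and> (\<exists>\<tau>\<in>T. w p (\<tau> u) \<noteq> 1)}"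
proof -
  have "w p (\<tau> (inverse u)) > 1" if "Factorial_Ring.prime p" "\<tau> \<in> T" "w p (\<tau> u) < 1" for p \<tau>
  proof -
    interpret padic_abs_on_field p t "w p"
      by (rule wf) fact
    have iu: "inverse u \<in> adj z"
      by (rule adj_inverse[OF alg_z u(1)])
    have "\<tau> u * \<tau> (inverse u) = 1"
      using T_mult[OF that(2) u(1) iu] T_1[OF that(2)] u(2) by simp
    hence "w p (\<tau> u) * w p (\<tau> (inverse u)) = 1"
      using mult[OF T_mem[OF that(2) u(1)] T_mem[OF that(2) iu]] one by simp
    thus ?thesis
      using that(3) w_pos[OF that(1,2) u] by (metis less_eq_real_def mult_less_cancel_left_pos mult.right_neutral not_less_iff_gr_or_eq)
  qed
  hence "{p. Factorial_Ring.prime p \<and> (\<exists>\<tau>\<in>T. w p (\<tau> u) \<noteq> 1)} \<subseteq>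
    {p. Factorial_Ring.prime p \<and> (\<exists>\<tau>\<in>T. w p (\<tau> u) > 1)} \<union>
    {p. Factorial_Ring.prime p \<and> (\<exists>\<tau>\<in>T. w p (\<tau> (inverse u)) > 1)}"
    by (auto simp: neq_iff)
  thus ?thesis
    using finite_conjugates_gt_1[OF u(1)] finite_conjugates_gt_1[OF adj_inverse[OF alg_z u(1)]]
    by (meson finite_UnI finite_subset)
qed

text \<open>All absolute values are multiplicative, so both sums are logarithms of absolute values
  of the one rational number q, the signed norm of u.\<close>

lemma product_formula_conjugates:
  assumes u: "u \<in> adj z" "u \<noteq> 0" and S: "finite S" "\<And>p. p \<in> S \<Longrightarrow> Factorial_Ring.prime p"
    and out: "\<And>p \<tau>. Factorial_Ring.prime p \<Longrightarrow> p \<notin> S \<Longrightarrow> \<tau> \<in> T \<Longrightarrow> w p (\<tau> u) = 1"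
  shows "(\<Sum>\<tau>\<in>T. ln (cmod (\<tau> u))) + (\<Sum>p\<in>S. \<Sum>\<tau>\<in>T. ln (w p (\<tau> u))) = 0"
proof -
  obtain q where q: "(\<Prod>\<tau>\<in>T. - \<tau> u) = of_rat q"
    using norm_rational[OF u(1)] .
  have "(\<Prod>\<tau>\<in>T. - \<tau> u) \<noteq> 0"
    using T_nonzero u by simp
  hence q0: "q \<noteq> 0"
    using q by auto
  have "(of_rat q :: complex) = of_real (of_rat q)"
    by (cases q) (simp add: of_rat_rat)
  hence "cmod (of_rat q) = \<bar>real_of_rat q\<bar>"
    by simp
  hence arch: "\<bar>real_of_rat q\<bar> = (\<Prod>\<tau>\<in>T. cmod (\<tau> u))"
    by (simp add: prod_norm [symmetric] flip: q)
  have padic: "padic_abs p q = (\<Prod>\<tau>\<in>T. w p (\<tau> u))" if "Factorial_Ring.prime p" for p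
  proof -
    interpret padic_abs_on_field p t "w p"
      by (rule wf) fact
    show ?thesis
      using prod[of T "\<lambda>\<tau>. - \<tau> u"] T_mem u
      by (simp add: adj_uminus uminus q of_rat)
  qed
  have "ln \<bar>real_of_rat q\<bar> + (\<Sum>p\<in>S. ln (padic_abs p q)) = 0"
    using q0 S out by (intro product_formula) (auto simp: padic)
  moreover have "ln \<bar>real_of_rat q\<bar> = (\<Sum>\<tau>\<in>T. ln (cmod (\<tau> u)))"
    unfolding arch using T_nonzero u by (intro ln_prod) auto
  moreover have "(\<Sum>p\<in>S. ln (padic_abs p q)) = (\<Sum>p\<in>S. \<Sum>\<tau>\<in>T. ln (w p (\<tau> u)))"
  proof (intro sum.cong refl)
    fix p assume "p \<in> S"
    hence p: "Factorial_Ring.prime p"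
      by (rule S(2))
    show "ln (padic_abs p q) = (\<Sum>\<tau>\<in>T. ln (w p (\<tau> u)))"
      unfolding padic[OF p] using w_pos[OF p _ u] by (intro ln_prod) (force simp: less_le)+
  qed
  ultimately show ?thesis
    by simp
qed

lemma kronecker:
  assumes u: "u \<in> adj z" "u \<noteq> 0"
    and arch: "\<And>\<tau>. \<tau> \<in> T \<Longrightarrow> cmod (\<tau> u) \<le> 1"
    and padic: "\<And>p \<tau>. Factorial_Ring.prime p \<Longrightarrow> \<tau> \<in> T \<Longrightarrow> w p (\<tau> u) \<le> 1"
  shows "\<exists>n>0. u ^ n = 1"
proof -
  \<comment> \<open>The integers allowed by \<open>coeff_prod_linear_bound\<close>. The bound
    depends on the degree \<open>card T\<close> alone, so it serves all powers of u at once.\<close>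
  define A :: "complex set" where "A = of_int ` {- (2 ^ card T)..2 ^ card T}"
  define PP where "PP = Poly ` {xs. set xs \<subseteq> A \<and> length xs = Suc (card T)}"
  have fin: "finite PP"
    unfolding PP_def A_def by (intro finite_imageI finite_lists_length_eq) auto
  have coeff_A: "Polynomial.coeff (charpoly (u ^ k)) i \<in> A" for k i
  proof -
    have uk: "u ^ k \<in> adj z"
      by (rule adj_power[OF u(1)])
    obtain q where q: "Polynomial.coeff (charpoly (u ^ k)) i = of_rat q"
      using charpoly_coeff[OF uk] by (auto elim: Rats_cases)
    have "padic_abs p q \<le> 1" if p: "Factorial_Ring.prime p" for p
    proof -
      interpret padic_abs_on_field p t "w p"
        by (rule wf) fact
      have "w p (\<tau> (u ^ k)) \<le> 1" if "\<tau> \<in> T" for \<tau>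
        using that padic[OF p that] nonneg[of "\<tau> u"] u T_mem
        by (simp add: T_power power power_le_one)
      hence "w p (Polynomial.coeff (charpoly (u ^ k)) i) \<le> 1"
        unfolding charpoly_def
        using coeff_prod_linear_le_1[of T "\<lambda>\<tau>. \<tau> (u ^ k)"] T_mem uk by auto
      thus ?thesis
        by (simp add: q of_rat)
    qed
    hence "q \<in> \<int>"
      by (rule Ints_if_padic_abs_le_1)
    then obtain n where n: "q = of_int n"
      by (rule Ints_cases)
    have "cmod (Polynomial.coeff (charpoly (u ^ k)) i) \<le> 2 ^ card T"
      unfolding charpoly_def
      using arch u by (intro coeff_prod_linear_bound) (auto simp: T_power norm_power power_le_one)
    hence "\<bar>real_of_int n\<bar> \<le> 2 ^ card T"
      by (simp add: q n)
    hence "\<bar>n\<bar> \<le> 2 ^ card T"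
      by (metis of_int_abs of_int_le_iff of_int_numeral of_int_power)
    thus ?thesis
      unfolding A_def q n by (intro image_eqI[of _ _ n]) auto
  qed
  have "charpoly (u ^ k) \<in> PP" for k
    unfolding PP_def
  proof (rule image_eqI)
    \<comment> \<open>Every \<open>charpoly (u ^ k)\<close> has degree \<open>card T\<close>, so its
      list of coefficients has the fixed length \<open>Suc (card T)\<close>.\<close>
    let ?xs = "map (Polynomial.coeff (charpoly (u ^ k))) [0..<Suc (card T)]"
    show "charpoly (u ^ k) = Poly ?xs"
      by (rule poly_eqI)
         (auto simp: coeff_Poly_eq nth_default_def degree_charpoly less_Suc_eq_le not_le intro!: coeff_eq_0 simp del: upt_Suc)
    show "?xs \<in> {xs. set xs \<subseteq> A \<and> length xs = Suc (card T)}"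
      using coeff_A by auto
  qed
  hence sub: "range (\<lambda>k. charpoly (u ^ k)) \<subseteq> PP"
    by blast
  have "range (\<lambda>k. u ^ k) \<subseteq> (\<Union>P\<in>range (\<lambda>k. charpoly (u ^ k)). {x. poly P x = 0})"
  proof safe
    fix k
    \<comment> \<open>The inclusion is one of the embeddings, so u ^ k is itself a root of its
      characteristic polynomial.\<close>
    have "restrict id (adj z) \<in> T"
      using adj_of_rat[of 1 z] by (intro embeddingsI) (auto intro: adj_add adj_mult)
    from poly_charpoly_conjugate[OF this, of "u ^ k"] adj_power[OF u(1)]
    show "u ^ k \<in> (\<Union>P\<in>range (\<lambda>k. charpoly (u ^ k)). {x. poly P x = 0})"
      by auto
  qed
  moreover have "finite (\<Union>P\<in>range (\<lambda>k. charpoly (u ^ k)). {x. poly P x = 0})"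
    by (rule finite_UN_I[OF finite_subset[OF sub fin]]) (auto simp: poly_roots_finite charpoly_nonzero)
  ultimately have "finite (range (\<lambda>k. u ^ k))"
    using finite_subset by blast
  hence "\<not> inj (\<lambda>k. u ^ k)"
    using range_inj_infinite by blast
  \<comment> \<open>Finitely many polynomials have finitely many roots, so two powers of u
    coincide.\<close>
  then obtain j k where jk: "u ^ j = u ^ k" "j < k"
    by (metis (mono_tags, lifting) injI linorder_neqE_nat)
  have "u ^ j * u ^ (k - j) = u ^ k"
    using jk(2) by (simp flip: power_add)
  also have "\<dots> = u ^ j * 1"
    using jk(1) by simp
  finally have "u ^ (k - j) = 1"
    using u(2) by simp
  thus ?thesis
    using jk(2) by (intro exI[of _ "k - j"]) auto
qed

end

section \<open>Heights\<close>

lemma ln_norm_ge: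
  fixes x y :: real
  assumes "x > 0" "y > 0"
  shows "ln 2 / 2 + (ln x + ln y) / 2 \<le> ln (sqrt (x\<^sup>2 + y\<^sup>2))"
    and "ln (sqrt (x\<^sup>2 + y\<^sup>2)) = ln 2 / 2 + (ln x + ln y) / 2 \<longleftrightarrow> x = y"
proof -
  have pos: "x\<^sup>2 + y\<^sup>2 > 0"
    using assms by (simp add: add_pos_pos)
  have l: "ln (sqrt (x\<^sup>2 + y\<^sup>2)) = ln (x\<^sup>2 + y\<^sup>2) / 2"
    using pos by (simp add: ln_sqrt)
  have r: "ln 2 / 2 + (ln x + ln y) / 2 = ln (2 * (x * y)) / 2"
    using assms by (simp add: ln_mult)
  have sq: "x\<^sup>2 + y\<^sup>2 - 2 * (x * y) = (x - y)\<^sup>2"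
    by (simp add: power2_diff)
  have "2 * (x * y) \<le> x\<^sup>2 + y\<^sup>2"
    using sq zero_le_power2[of "x - y"] by linarith
  thus "ln 2 / 2 + (ln x + ln y) / 2 \<le> ln (sqrt (x\<^sup>2 + y\<^sup>2))"
    unfolding l r using assms pos by simp
  have "ln (sqrt (x\<^sup>2 + y\<^sup>2)) = ln 2 / 2 + (ln x + ln y) / 2 \<longleftrightarrow> x\<^sup>2 + y\<^sup>2 = 2 * (x * y)"
    unfolding l r using assms pos by simp
  also have "\<dots> \<longleftrightarrow> (x - y)\<^sup>2 = 0"
    using sq by linarith
  finally show "ln (sqrt (x\<^sup>2 + y\<^sup>2)) = ln 2 / 2 + (ln x + ln y) / 2 \<longleftrightarrow> x = y"
    by simp
qed

lemma ln_max_ge: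
  fixes x y :: real
  assumes "x > 0" "y > 0"
  shows "(ln x + ln y) / 2 \<le> ln (max x y)"
    and "ln (max x y) = (ln x + ln y) / 2 \<longleftrightarrow> x = y"
proof -
  have m: "ln (max x y) = max (ln x) (ln y)"
    using assms by (auto simp: max_def)
  show "(ln x + ln y) / 2 \<le> ln (max x y)"
    unfolding m by (auto simp: max_def)
  have "ln (max x y) = (ln x + ln y) / 2 \<longleftrightarrow> ln x = ln y"
    unfolding m by (auto simp: max_def)
  thus "ln (max x y) = (ln x + ln y) / 2 \<longleftrightarrow> x = y"
    using assms by simp
qed

context number_field_places
begin

text \<open>The height multiplied by the degree \<open>card T\<close>, with the p-adic terms already
  rewritten over the complex embeddings.\<close>

definition height_sum :: "complex \<Rightarrow> complex \<Rightarrow> real" where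
  "height_sum a b = (\<Sum>\<tau>\<in>T. ln (sqrt ((cmod (\<tau> a))\<^sup>2 + (cmod (\<tau> b))\<^sup>2))) +
    (\<Sum>\<^sub>\<infinity>p\<in>{p. Factorial_Ring.prime p}. \<Sum>\<tau>\<in>T. ln (max (w p (\<tau> a)) (w p (\<tau> b))))"

text \<open>The excess over the lower bound is a finite sum of nonnegative defects, one for each
  embedding and place, so it vanishes exactly when every defect does.\<close>

lemma height_sum_bound:
  assumes a: "a \<in> adj z" "a \<noteq> 0" and b: "b \<in> adj z" "b \<noteq> 0"
  shows "real (card T) * (ln 2 / 2) \<le> height_sum a b"
    and "height_sum a b = real (card T) * (ln 2 / 2) \<longleftrightarrow>
      (\<forall>\<tau>\<in>T. cmod (\<tau> a) = cmod (\<tau> b)) \<and>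
      (\<forall>p. Factorial_Ring.prime p \<longrightarrow> (\<forall>\<tau>\<in>T. w p (\<tau> a) = w p (\<tau> b)))"
proof -
  define S where "S = {p. Factorial_Ring.prime p \<and> (\<exists>\<tau>\<in>T. w p (\<tau> a) \<noteq> 1)} \<union>
    {p. Factorial_Ring.prime p \<and> (\<exists>\<tau>\<in>T. w p (\<tau> b) \<noteq> 1)}"
  have S: "finite S" "\<And>p. p \<in> S \<Longrightarrow> Factorial_Ring.prime p"
    unfolding S_def using finite_conjugates_neq_1[OF a] finite_conjugates_neq_1[OF b] by auto
  have out: "w p (\<tau> a) = 1" "w p (\<tau> b) = 1" if "Factorial_Ring.prime p" "p \<notin> S" "\<tau> \<in> T" for p \<tau>
    using that by (auto simp: S_def)
  have pf: "(\<Sum>\<tau>\<in>T. ln (cmod (\<tau> u))) + (\<Sum>p\<in>S. \<Sum>\<tau>\<in>T. ln (w p (\<tau> u))) = 0" if "u = a \<or> u = b" for u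
    using that a b S out by (intro product_formula_conjugates) auto
  \<comment> \<open>D and E are the defects of the two termwise inequalities. The subtracted
    logarithms cancel in total by \<open>pf\<close>, which leaves (log 2)/2 for each
    embedding.\<close>
  define D where "D \<tau> = ln (sqrt ((cmod (\<tau> a))\<^sup>2 + (cmod (\<tau> b))\<^sup>2)) -
    (ln 2 / 2 + (ln (cmod (\<tau> a)) + ln (cmod (\<tau> b))) / 2)" for \<tau>
  define E where "E p \<tau> = ln (max (w p (\<tau> a)) (w p (\<tau> b))) - (ln (w p (\<tau> a)) + ln (w p (\<tau> b))) / 2" for p \<tau>
  have D: "D \<tau> \<ge> 0" "D \<tau> = 0 \<longleftrightarrow> cmod (\<tau> a) = cmod (\<tau> b)" if "\<tau> \<in> T" for \<tau>
    using ln_norm_ge[of "cmod (\<tau> a)" "cmod (\<tau> b)"] T_nonzero[OF that a] T_nonzero[OF that b]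
    by (auto simp: D_def)
  have E: "E p \<tau> \<ge> 0" "E p \<tau> = 0 \<longleftrightarrow> w p (\<tau> a) = w p (\<tau> b)" if "\<tau> \<in> T" "Factorial_Ring.prime p" for p \<tau>
    using ln_max_ge[OF w_pos[OF that(2,1) a] w_pos[OF that(2,1) b]] by (auto simp: E_def)
  \<comment> \<open>At primes outside S both values are 1, so the term is log 1 = 0.\<close>
  have "(\<Sum>\<^sub>\<infinity>p\<in>{p. Factorial_Ring.prime p}. \<Sum>\<tau>\<in>T. ln (max (w p (\<tau> a)) (w p (\<tau> b)))) =
      (\<Sum>\<^sub>\<infinity>p\<in>S. \<Sum>\<tau>\<in>T. ln (max (w p (\<tau> a)) (w p (\<tau> b))))"
    using S(2) out by (intro infsum_cong_neutral) auto
  also have "\<dots> = (\<Sum>p\<in>S. \<Sum>\<tau>\<in>T. ln (max (w p (\<tau> a)) (w p (\<tau> b))))"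
    using S(1) by simp
  finally have "height_sum a b = (\<Sum>\<tau>\<in>T. D \<tau> + (ln 2 / 2 + (ln (cmod (\<tau> a)) + ln (cmod (\<tau> b))) / 2)) +
      (\<Sum>p\<in>S. \<Sum>\<tau>\<in>T. E p \<tau> + (ln (w p (\<tau> a)) + ln (w p (\<tau> b))) / 2)"
    by (simp add: height_sum_def D_def E_def)
  also have "\<dots> = (\<Sum>\<tau>\<in>T. D \<tau>) + (\<Sum>p\<in>S. \<Sum>\<tau>\<in>T. E p \<tau>) + real (card T) * (ln 2 / 2) +
      ((\<Sum>\<tau>\<in>T. ln (cmod (\<tau> a))) + (\<Sum>p\<in>S. \<Sum>\<tau>\<in>T. ln (w p (\<tau> a)))) / 2 +
      ((\<Sum>\<tau>\<in>T. ln (cmod (\<tau> b))) + (\<Sum>p\<in>S. \<Sum>\<tau>\<in>T. ln (w p (\<tau> b)))) / 2"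
    by (simp add: sum.distrib add_divide_distrib flip: sum_divide_distrib)
  finally have h: "height_sum a b = (\<Sum>\<tau>\<in>T. D \<tau>) + (\<Sum>p\<in>S. \<Sum>\<tau>\<in>T. E p \<tau>) + real (card T) * (ln 2 / 2)"
    using pf[of a] pf[of b] by simp
  have nonneg: "(\<Sum>\<tau>\<in>T. D \<tau>) \<ge> 0" "(\<Sum>p\<in>S. \<Sum>\<tau>\<in>T. E p \<tau>) \<ge> 0"
    using D E S(2) by (auto intro!: sum_nonneg)
  show "real (card T) * (ln 2 / 2) \<le> height_sum a b"
    using h nonneg by linarith
  have "height_sum a b = real (card T) * (ln 2 / 2) \<longleftrightarrow>
      (\<Sum>\<tau>\<in>T. D \<tau>) = 0 \<and> (\<Sum>p\<in>S. \<Sum>\<tau>\<in>T. E p \<tau>) = 0"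
    using h nonneg by linarith
  also have "(\<Sum>\<tau>\<in>T. D \<tau>) = 0 \<longleftrightarrow> (\<forall>\<tau>\<in>T. cmod (\<tau> a) = cmod (\<tau> b))"
    using D by (subst sum_nonneg_eq_0_iff) auto
  also have "(\<Sum>p\<in>S. \<Sum>\<tau>\<in>T. E p \<tau>) = 0 \<longleftrightarrow> (\<forall>p\<in>S. (\<Sum>\<tau>\<in>T. E p \<tau>) = 0)"
    using E S by (intro sum_nonneg_eq_0_iff) (auto intro!: sum_nonneg)
  also have "\<dots> \<longleftrightarrow> (\<forall>p\<in>S. \<forall>\<tau>\<in>T. w p (\<tau> a) = w p (\<tau> b))"
    using E S(2) by (intro ball_cong refl) (subst sum_nonneg_eq_0_iff, auto)
  \<comment> \<open>Outside S the required equality reads 1 = 1.\<close>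
  also have "\<dots> \<longleftrightarrow> (\<forall>p. Factorial_Ring.prime p \<longrightarrow> (\<forall>\<tau>\<in>T. w p (\<tau> a) = w p (\<tau> b)))"
    using S(2) out by metis
  finally show "height_sum a b = real (card T) * (ln 2 / 2) \<longleftrightarrow>
      (\<forall>\<tau>\<in>T. cmod (\<tau> a) = cmod (\<tau> b)) \<and>
      (\<forall>p. Factorial_Ring.prime p \<longrightarrow> (\<forall>\<tau>\<in>T. w p (\<tau> a) = w p (\<tau> b)))" .
qed

text \<open>Dividing by b turns equal absolute values of a and b into absolute value 1 for u = a /
  b. Kronecker's theorem gives one direction; conversely a root of unity has a power 1 in every
  embedding, so all its absolute values are 1.\<close>

lemma height_sum_eq_iff_root_of_unity:
  assumes a: "a \<in> adj z" "a \<noteq> 0" and b: "b \<in> adj z" "b \<noteq> 0"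
  shows "height_sum a b = real (card T) * (ln 2 / 2) \<longleftrightarrow> (\<exists>n>0. (a / b) ^ n = 1)"
proof -
  define u where "u = a / b"
  have u: "u \<in> adj z" "u \<noteq> 0"
    using a b adj_inverse[OF alg_z, of b] by (auto simp: u_def divide_inverse intro: adj_mult)
  have ab: "\<tau> a = \<tau> u * \<tau> b" if "\<tau> \<in> T" for \<tau>
    using T_mult[OF that u(1) b(1)] b(2) by (simp add: u_def)
  have arch: "cmod (\<tau> a) = cmod (\<tau> b) \<longleftrightarrow> cmod (\<tau> u) = 1" if "\<tau> \<in> T" for \<tau>
    using T_nonzero[OF that b] by (simp add: ab[OF that] norm_mult)
  have padic: "w p (\<tau> a) = w p (\<tau> b) \<longleftrightarrow> w p (\<tau> u) = 1" if "Factorial_Ring.prime p" "\<tau> \<in> T" for p \<tau>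
  proof -
    interpret padic_abs_on_field p t "w p"
      by (rule wf) fact
    show ?thesis
      using w_pos[OF that b] mult[OF T_mem[OF that(2) u(1)] T_mem[OF that(2) b(1)]]
      by (simp add: ab[OF that(2)])
  qed
  have "height_sum a b = real (card T) * (ln 2 / 2) \<longleftrightarrow>
      (\<forall>\<tau>\<in>T. cmod (\<tau> u) = 1) \<and> (\<forall>p. Factorial_Ring.prime p \<longrightarrow> (\<forall>\<tau>\<in>T. w p (\<tau> u) = 1))"
    using height_sum_bound(2)[OF a b] arch padic by simp
  also have "\<dots> \<longleftrightarrow> (\<exists>n>0. u ^ n = 1)"
  proof
    assume "(\<forall>\<tau>\<in>T. cmod (\<tau> u) = 1) \<and> (\<forall>p. Factorial_Ring.prime p \<longrightarrow> (\<forall>\<tau>\<in>T. w p (\<tau> u) = 1))"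
    thus "\<exists>n>0. u ^ n = 1"
      by (intro kronecker[OF u]) auto
  next
    assume "\<exists>n>0. u ^ n = 1"
    then obtain n where n: "n > 0" "u ^ n = 1"
      by blast
    have \<tau>n: "\<tau> u ^ n = 1" if "\<tau> \<in> T" for \<tau>
      using T_power[OF that u(1), of n] T_1[OF that] n by simp
    have "cmod (\<tau> u) = 1" if "\<tau> \<in> T" for \<tau>
    proof (rule power_eq_imp_eq_base[OF _ _ _ n(1)])
      show "cmod (\<tau> u) ^ n = 1 ^ n"
        using \<tau>n[OF that] by (simp flip: norm_power)
    qed auto
    moreover have "w p (\<tau> u) = 1" if "Factorial_Ring.prime p" "\<tau> \<in> T" for p \<tau>
    proof -
      interpret padic_abs_on_field p t "w p"
        by (rule wf) fact
      have "w p (\<tau> u) \<ge> 0"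
        using w_pos[OF that u] by (rule less_imp_le)
      moreover have "w p (\<tau> u) ^ n = 1 ^ n"
        using power[OF T_mem[OF that(2) u(1)], of n] \<tau>n[OF that(2)] one by simp
      ultimately show ?thesis
        using power_eq_imp_eq_base[OF _ _ zero_le_one n(1)] by blast
    qed
    ultimately show "(\<forall>\<tau>\<in>T. cmod (\<tau> u) = 1) \<and> (\<forall>p. Factorial_Ring.prime p \<longrightarrow> (\<forall>\<tau>\<in>T. w p (\<tau> u) = 1))"
      by blast
  qed
  finally show ?thesis
    by (simp add: u_def)
qed

end

text \<open>The field \<open>adj t\<close> is chosen once for all primes; only the absolute value w
  p varies with p, picked by \<open>choice\<close>.\<close>

lemma arakelov_height_places:
  fixes C :: "nat \<Rightarrow> 'c ring"
  assumes C: "\<And>p. Factorial_Ring.prime p \<Longrightarrow> padic_complex (C p) (av p) p"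
    and z: "Polynomial.algebraic z"
  obtains t f w where "number_field_places z t f w"
    "\<And>a b. a \<in> adj z \<Longrightarrow> b \<in> adj z \<Longrightarrow>
      arakelov_height C av (adj z) a b =
        number_field_places.height_sum z w a b / real (card (embeddings (adj z) CC))"
proof -
  obtain f where f: "minpoly_of f z"
    using minpoly_of_exists[OF z] by blast
  have alg: "Polynomial.algebraic x" if "x \<in> {x. rpoly f x = 0}" for x
    using that algebraic_iff_rpoly minpoly_ofD(2)[OF f] by blast
  obtain t where t: "Polynomial.algebraic t" "{x. rpoly f x = 0} \<subseteq> adj t"
    by (rule primitive_element[OF finite_rpoly_roots[OF minpoly_ofD(2)[OF f]] alg]) (assumption, rule that)
  have "\<forall>p. \<exists>w. Factorial_Ring.prime p \<longrightarrow> padic_abs_on p (adj t) w \<and>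
    (\<forall>a\<in>adj z. \<forall>b\<in>adj z. (\<Sum>\<sigma>\<in>embeddings (adj z) (C p). ln (max (av p (\<sigma> a)) (av p (\<sigma> b)))) =
      (\<Sum>\<tau>\<in>embeddings (adj z) CC. ln (max (w (\<tau> a)) (w (\<tau> b)))))"
    (is "\<forall>p. \<exists>w. _ \<longrightarrow> ?Q p w")
  proof
    fix p
    show "\<exists>w. Factorial_Ring.prime p \<longrightarrow> ?Q p w"
    proof (cases "Factorial_Ring.prime p")
      case True
      obtain w where "?Q p w"
        by (rule padic_places[OF C[OF True] prime_gt_0_nat[OF True] f t]) (use that in blast)
      thus ?thesis by blast
    qed simp
  qed
  from choice[OF this] obtain w where "\<And>p. Factorial_Ring.prime p \<Longrightarrow> ?Q p (w p)"
    by blast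
  hence w: "\<And>p. Factorial_Ring.prime p \<Longrightarrow> padic_abs_on p (adj t) (w p)"
    and sums: "\<And>p a b. Factorial_Ring.prime p \<Longrightarrow> a \<in> adj z \<Longrightarrow> b \<in> adj z \<Longrightarrow>
      (\<Sum>\<sigma>\<in>embeddings (adj z) (C p). ln (max (av p (\<sigma> a)) (av p (\<sigma> b)))) =
      (\<Sum>\<tau>\<in>embeddings (adj z) CC. ln (max (w p (\<tau> a)) (w p (\<tau> b))))"
    by blast+
  have loc: "number_field_places z t f w"
    by (intro number_field_places.intro number_field_places_axioms.intro number_field_in_normal.intro f t w)
  interpret number_field_places z t f w
    by (rule loc)
  show ?thesis
  proof (rule that[OF loc])
    fix a b assume ab: "a \<in> adj z" "b \<in> adj z"
    have "(\<Sum>\<^sub>\<infinity>p\<in>{p. Factorial_Ring.prime p}. \<Sum>\<sigma>\<in>embeddings (adj z) (C p). ln (max (av p (\<sigma> a)) (av p (\<sigma> b)))) =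
      (\<Sum>\<^sub>\<infinity>p\<in>{p. Factorial_Ring.prime p}. \<Sum>\<tau>\<in>T. ln (max (w p (\<tau> a)) (w p (\<tau> b))))"
      using sums ab by (intro infsum_cong) auto
    thus "arakelov_height C av (adj z) a b = height_sum a b / real (card T)"
      by (simp add: arakelov_height_def height_sum_def card_T)
  qed
qed

section \<open>Points of the projective line and their homogeneous coordinates\<close>

lemma proj_rel_iff:
  "(u, v) \<in> proj_rel \<longleftrightarrow> u \<in> homog_coords \<and> v \<in> homog_coords \<and>
    (\<exists>c. Polynomial.algebraic c \<and> c \<noteq> 0 \<and> fst v = c * fst u \<and> snd v = c * snd u)"
  by (cases u; cases v) (auto simp: proj_rel_def Qbar_def)

lemma equiv_proj_rel: "equiv homog_coords proj_rel"
proof (rule equivI)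
  show "proj_rel \<subseteq> homog_coords \<times> homog_coords"
    by (auto simp: proj_rel_def)
  show "refl_on homog_coords proj_rel"
    by (intro refl_onI) (auto simp: proj_rel_iff intro!: exI[of _ 1])
  show "sym proj_rel"
  proof (rule symI)
    fix u v assume "(u, v) \<in> proj_rel"
    then obtain c where "u \<in> homog_coords" "v \<in> homog_coords" "Polynomial.algebraic c" "c \<noteq> 0"
      "fst v = c * fst u" "snd v = c * snd u"
      unfolding proj_rel_iff by blast
    thus "(v, u) \<in> proj_rel"
      unfolding proj_rel_iff by (auto intro!: exI[of _ "inverse c"])
  qed
  show "trans proj_rel"
  proof (rule transI)
    fix u v x assume "(u, v) \<in> proj_rel" "(v, x) \<in> proj_rel"
    then obtain c d where "u \<in> homog_coords" "x \<in> homog_coords"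
      "Polynomial.algebraic c" "c \<noteq> 0" "Polynomial.algebraic d" "d \<noteq> 0"
      "fst v = c * fst u" "snd v = c * snd u" "fst x = d * fst v" "snd x = d * snd v"
      unfolding proj_rel_iff by blast
    thus "(u, x) \<in> proj_rel"
      unfolding proj_rel_iff by (auto intro!: exI[of _ "d * c"] algebraic_mult)
  qed
qed

lemma P1_Qbar_member:
  assumes "\<alpha> \<in> P1_Qbar" "(a0, a1) \<in> \<alpha>"
  shows "(a0, a1) \<in> homog_coords" "\<alpha> = proj_point a0 a1"
proof -
  show mem: "(a0, a1) \<in> homog_coords"
    using assms in_quotient_imp_subset[OF equiv_proj_rel] unfolding P1_Qbar_def by blast
  show "\<alpha> = proj_point a0 a1"
    using assms mem equiv_proj_rel unfolding P1_Qbar_def proj_point_def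
    by (metis Image_singleton_iff equiv_class_eq quotientE)
qed

text \<open>If (x0, x1) is not in \<open>homog_coords\<close>, then \<open>proj_point x0 x1\<close>
  is empty, whereas (a0, a1) lies in its own class. So the equality itself forces x0 and x1 to be
  admissible.\<close>

lemma proj_point_eq_iff:
  assumes "(a0, a1) \<in> homog_coords"
  shows "proj_point x0 x1 = proj_point a0 a1 \<longleftrightarrow> ((x0, x1), (a0, a1)) \<in> proj_rel"
proof
  assume "proj_point x0 x1 = proj_point a0 a1"
  moreover have "(a0, a1) \<in> proj_point a0 a1"
    unfolding proj_point_def using equiv_class_self[OF equiv_proj_rel assms] .
  ultimately show "((x0, x1), (a0, a1)) \<in> proj_rel"
    by (auto simp: proj_point_def)
next
  assume "((x0, x1), (a0, a1)) \<in> proj_rel"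
  thus "proj_point x0 x1 = proj_point a0 a1"
    unfolding proj_point_def by (rule equiv_class_eq[OF equiv_proj_rel])
qed

lemma affine_point_eq_iff:
  assumes "(a0, a1) \<in> homog_coords" "a1 \<noteq> 0"
  shows "proj_point a0 a1 = affine_point x \<longleftrightarrow> x = a0 / a1"
proof -
  have alg: "Polynomial.algebraic a0" "Polynomial.algebraic a1"
    using assms by (auto simp: homog_coords_def Qbar_def)
  have "proj_point a0 a1 = affine_point x \<longleftrightarrow> ((x, 1), (a0, a1)) \<in> proj_rel"
    using proj_point_eq_iff[OF assms(1)] by metis
  also have "\<dots> \<longleftrightarrow> x = a0 / a1"
  proof
    assume "x = a0 / a1"
    moreover from this have "Polynomial.algebraic x"
      using alg by (auto simp: divide_inverse intro: algebraic_mult)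
    ultimately show "((x, 1), (a0, a1)) \<in> proj_rel"
      using assms alg by (auto simp: proj_rel_def homog_coords_def Qbar_def)
  qed (use assms in \<open>auto simp: proj_rel_def\<close>)
  finally show ?thesis .
qed

theorem theorem1:
  fixes C :: "nat \<Rightarrow> 'c ring" and av :: "nat \<Rightarrow> 'c \<Rightarrow> real"
    and \<alpha> :: "(complex \<times> complex) set" and K :: "complex set" and a0 a1 :: complex
  assumes "\<And>p. Factorial_Ring.prime p \<Longrightarrow> padic_complex (C p) (av p) p"
    and "\<alpha> \<in> P1_Qbar - {affine_point 0, infinity_point}"
    and "number_field K" and "a0 \<in> K" and "a1 \<in> K" and "(a0, a1) \<in> \<alpha>"
  shows "arakelov_height C av K a0 a1 \<ge> 1 / 2 * ln 2 \<and>
    (arakelov_height C av K a0 a1 = 1 / 2 * ln 2 \<longleftrightarrow>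
      (\<exists>(\<zeta>::complex) (n::nat). n > 0 \<and> \<zeta> ^ n = 1 \<and> \<alpha> = affine_point \<zeta>))"
proof -
  have hom: "(a0, a1) \<in> homog_coords" and \<alpha>: "\<alpha> = proj_point a0 a1"
    using P1_Qbar_member assms(2,6) by auto
  have a1: "a1 \<noteq> 0"
  proof
    \<comment> \<open>Then a0 is a nonzero algebraic scale factor and the point is infinity.\<close>
    assume "a1 = 0"
    hence "((1, 0), (a0, a1)) \<in> proj_rel"
      using hom by (auto simp: proj_rel_def homog_coords_def Qbar_def)
    thus False
      using proj_point_eq_iff[OF hom] \<alpha> assms(2) by auto
  qed
  hence a0: "a0 \<noteq> 0"
    using affine_point_eq_iff[OF hom a1, of 0] \<alpha> assms(2) by auto
  obtain z where z: "Polynomial.algebraic z" "K = adj z"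
    using number_field_adj[OF assms(3)] .
  obtain t f w where places: "number_field_places z t f w"
    and h: "\<And>a b. a \<in> adj z \<Longrightarrow> b \<in> adj z \<Longrightarrow>
      arakelov_height C av (adj z) a b =
        number_field_places.height_sum z w a b / real (card (embeddings (adj z) CC))"
    by (rule arakelov_height_places[OF assms(1) z(1)]) (assumption, rule that)
  interpret number_field_places z t f w
    by (rule places)
  have a: "a0 \<in> adj z" "a1 \<in> adj z"
    using assms(4,5) z(2) by auto
  define d where "d = real (card T)"
  have d: "d > 0"
    using card_T_pos by (simp add: d_def)
  have h: "arakelov_height C av K a0 a1 = height_sum a0 a1 / d"
    using h[OF a] z(2) by (simp add: d_def)
  note bound = height_sum_bound(1)[OF a(1) a0 a(2) a1, folded d_def]
  have "1 / 2 * ln 2 \<le> arakelov_height C av K a0 a1"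
    using bound d by (simp add: h field_simps)
  moreover have "arakelov_height C av K a0 a1 = 1 / 2 * ln 2 \<longleftrightarrow> height_sum a0 a1 = d * (ln 2 / 2)"
    using d by (simp add: h field_simps)
  \<comment> \<open>The affine coordinate of \<alpha> is unique, so a0 / a1 is the only candidate
    for \<zeta>.\<close>
  moreover have "(\<exists>n>0. (a0 / a1) ^ n = 1) \<longleftrightarrow> (\<exists>\<zeta> n. n > 0 \<and> \<zeta> ^ n = 1 \<and> \<alpha> = affine_point \<zeta>)"
    using affine_point_eq_iff[OF hom a1] \<alpha> by simp
  ultimately show ?thesis
    using height_sum_eq_iff_root_of_unity[OF a(1) a0 a(2) a1, folded d_def] by simp
qed

end
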